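(* Let $\mathfrak{a} = \bigcap_{\sigma\ge 2}\mathcal{A}_\sigma$ denote the set of omnipersistent actual signatures, that is, the tuples that are actual signatures for every genus $\sigma\ge 2$. Then \[ \mathfrak{a} = \{ (2;-),\ (1;2,2),\ (0;2,2,2,2,2),\ (0;2,2,2,2,2,2)\}. \]
   Context: Let $\sigma \ge 2$ be an integer. A tuple $(h;m_1,\ldots,m_r)$, where $h\ge 0$ and $r\ge 0$ are integers and $m_1,\ldots,m_r\ge 2$ are integers (written $(h;-)$ when $r=0$), is an actual signature for genus $\sigma$ if there exist a closed Riemann surface $X$ of genus $\sigma$ and a (necessarily finite) group $G$ of conformal homeomorphisms of $X$ such that the quotient $X/G$ has genus $h$ and the quotient map $X\to X/G$ has exactly $r$ branch points, of orders $m_1,\ldots,m_r$. $\mathcal{A}_\sigma$ denotes the set of all actual signatures for genus $\sigma$. By Riemann's existence theorem (a known result), this is equivalent to the existence of a finite group $G$, of order $N$, such that: (i) $m_i\mid N$ for all $1\le i\le r$ and $\sigma-1 = N\left(h-1+\frac12\sum_{i=1}^r\left(1-\frac1{m_i}\right)\right)$; and (ii) $G$ has an $(h;m_1,\ldots,m_r)$-generating vector, i.e. a vector $(a_1,b_1,\ldots,a_h,b_h,c_1,\ldots,c_r)$ of elements of $G$ which together generate $G$, such that $c_i$ has order $m_i$ for $1\le i\le r$, and $\prod_{i=1}^h[a_i,b_i]\prod_{j=1}^r c_j = 1$. *)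

theory Defs
  imports
    "HOL-Complex_Analysis.Complex_Analysis"
    "HOL-Homology.Homology"
    "HOL-Algebra.Group_Action"
    "HOL-Algebra.Generated_Groups"
    "HOL-Algebra.Multiplicative_Group"
begin

text \<open>
  A signature \<open>(h; m\<^sub>1, \<dots>, m\<^sub>r)\<close> is the pair of \<open>h\<close> and the list of the \<open>m\<^sub>i\<close>; in particular
  \<open>(h; -)\<close> is \<open>(h, [])\<close>.
\<close>

type_synonym signature = "nat \<times> nat list"


section \<open>Riemann surfaces and signatures of group actions\<close>

text \<open>
  A chart is a pair of an open set and a map on it. Only the values of the map on that set matter.
\<close>

type_synonym 'a chart = "'a set \<times> ('a \<Rightarrow> complex)"

definition is_chart :: "'a topology \<Rightarrow> 'a chart \<Rightarrow> bool" where
  "is_chart X c \<longleftrightarrow> (case c of (U, \<phi>) \<Rightarrow>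
     openin X U \<and> open (\<phi> ` U) \<and>
     homeomorphic_map (subtopology X U) (subtopology euclidean (\<phi> ` U)) \<phi>)"

text \<open>The expression of \<open>g\<close> in the given charts is \<open>\<psi> \<circ> g \<circ> \<phi>\<^sup>-\<^sup>1\<close>.\<close>

definition holomorphic_in_charts :: "('a \<Rightarrow> 'b) \<Rightarrow> 'a chart \<Rightarrow> 'b chart \<Rightarrow> bool" where
  "holomorphic_in_charts g c d \<longleftrightarrow> (case (c, d) of ((U, \<phi>), (V, \<psi>)) \<Rightarrow>
     (\<psi> \<circ> g \<circ> inv_into U \<phi>) holomorphic_on \<phi> ` {x \<in> U. g x \<in> V})"

definition closed_riemann_surface :: "'a topology \<Rightarrow> 'a chart set \<Rightarrow> bool" where
  "closed_riemann_surface X \<A> \<longleftrightarrow>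
     topspace X \<noteq> {} \<and> connected_space X \<and> compact_space X \<and> Hausdorff_space X \<and>
     (\<forall>c\<in>\<A>. is_chart X c) \<and> (\<Union>c\<in>\<A>. fst c) = topspace X \<and>
     (\<forall>c\<in>\<A>. \<forall>d\<in>\<A>. holomorphic_in_charts (\<lambda>x. x) c d)"

definition conformal_homeomorphism :: "'a topology \<Rightarrow> 'a chart set \<Rightarrow> ('a \<Rightarrow> 'a) \<Rightarrow> bool" where
  "conformal_homeomorphism X \<A> g \<longleftrightarrow>
     homeomorphic_map X X g \<and> (\<forall>c\<in>\<A>. \<forall>d\<in>\<A>. holomorphic_in_charts g c d)"

text \<open>
  The genus of a closed (connected, orientable) surface, defined by \<open>H\<^sub>1(X; \<int>) \<cong> \<int>\<^bsup>2g\<^esup>\<close>.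
\<close>

definition has_genus :: "'a topology \<Rightarrow> nat \<Rightarrow> bool" where
  "has_genus X g \<longleftrightarrow> homology_group 1 X \<cong> free_Abelian_group {..<2 * g}"

text \<open>
  The signature of a group of self-bijections of \<open>X\<close> with carrier \<open>H\<close>. The points of \<open>X/H\<close> are
  the orbits, and \<^const>\<open>quotient_map\<close> determines the topology of \<open>X/H\<close>. The branch points are the
  orbits of points with non-trivial stabilizer, and the order of a branch point is the order of
  the stabilizer of any point above it, i.e. the local degree of the quotient map there. The list
  \<open>bs\<close> enumerates the branch points without repetition.
\<close>

definition action_has_signature :: "'a topology \<Rightarrow> ('a \<Rightarrow> 'a) set \<Rightarrow> signature \<Rightarrow> bool" where
  "action_has_signature X H s \<longleftrightarrow> (case s of (h, ms) \<Rightarrow>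
     let G = (BijGroup (topspace X))\<lparr>carrier := H\<rparr> in
     (\<exists>Y. quotient_map X Y (orbit G id) \<and> has_genus Y h) \<and>
     (\<exists>bs. distinct bs \<and>
        set bs = orbit G id ` {x \<in> topspace X. card (stabilizer G id x) \<noteq> 1} \<and>
        length bs = length ms \<and>
        (\<forall>i < length ms. \<forall>x \<in> bs ! i. card (stabilizer G id x) = ms ! i)))"

text \<open>
  The set \<open>\<A>\<^sub>\<sigma>\<close>. A closed surface has the cardinality of the continuum, so that every closed
  Riemann surface is isomorphic to one whose points are the elements of a set of reals. The
  topology of \<open>X\<close> is unrelated to that of the real line.
\<close>

definition actual_signatures :: "nat \<Rightarrow> signature set" where
  "actual_signatures \<sigma> = {s. (\<forall>m \<in> set (snd s). m \<ge> 2) \<and>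
     (\<exists>(X :: real topology) \<A> H.
        closed_riemann_surface X \<A> \<and> has_genus X \<sigma> \<and>
        subgroup H (BijGroup (topspace X)) \<and> finite H \<and>
        (\<forall>g\<in>H. conformal_homeomorphism X \<A> g) \<and>
        action_has_signature X H s)}"


section \<open>Generating vectors\<close>

definition list_prod :: "('g, 'b) monoid_scheme \<Rightarrow> 'g list \<Rightarrow> 'g" where
  "list_prod G xs = foldr (mult G) xs (one G)"

definition commutator :: "('g, 'b) monoid_scheme \<Rightarrow> 'g \<Rightarrow> 'g \<Rightarrow> 'g" where
  "commutator G a b = a \<otimes>\<^bsub>G\<^esub> b \<otimes>\<^bsub>G\<^esub> inv\<^bsub>G\<^esub> a \<otimes>\<^bsub>G\<^esub> inv\<^bsub>G\<^esub> b"

text \<open>The vector \<open>(a\<^sub>1, b\<^sub>1, \<dots>, a\<^sub>h, b\<^sub>h, c\<^sub>1, \<dots>, c\<^sub>r)\<close> is given by its three parts.\<close>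

definition generating_vector ::
  "('g, 'b) monoid_scheme \<Rightarrow> signature \<Rightarrow> 'g list \<Rightarrow> 'g list \<Rightarrow> 'g list \<Rightarrow> bool" where
  "generating_vector G s as bs cs \<longleftrightarrow> (case s of (h, ms) \<Rightarrow>
     length as = h \<and> length bs = h \<and> length cs = length ms \<and>
     set as \<union> set bs \<union> set cs \<subseteq> carrier G \<and>
     generate G (set as \<union> set bs \<union> set cs) = carrier G \<and>
     (\<forall>i < length ms. group.ord G (cs ! i) = ms ! i) \<and>
     list_prod G (map2 (commutator G) as bs) \<otimes>\<^bsub>G\<^esub> list_prod G cs = \<one>\<^bsub>G\<^esub>)"

text \<open>
  The signatures satisfying the group-theoretic criterion of Riemann's existence theorem for
  genus \<open>\<sigma>\<close>. Every finite group is isomorphic to one on a set of natural numbers.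
\<close>

definition riemann_signatures :: "nat \<Rightarrow> signature set" where
  "riemann_signatures \<sigma> = {(h, ms). (\<forall>m \<in> set ms. m \<ge> 2) \<and>
     (\<exists>G :: nat monoid. group G \<and> finite (carrier G) \<and>
        (\<forall>m \<in> set ms. m dvd order G) \<and>
        real \<sigma> - 1 =
          real (order G) * (real h - 1 + 1 / 2 * (\<Sum>m\<leftarrow>ms. 1 - 1 / real m)) \<and>
        (\<exists>as bs cs. generating_vector G (h, ms) as bs cs))}"

end

theory Submission
  imports Defs "HOL-Algebra.Sylow" "HOL-Number_Theory.Number_Theory"
begin

text \<open>
  The four signatures are realized, for \<open>n = \<sigma> - 1\<close>, by the cyclic group of order \<open>n\<close> and by dihedral
  groups of order \<open>2 n\<close> and \<open>4 n\<close>.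

  Conversely, genus 2 gives a group of some order \<open>k\<close>, with \<open>k \<le> 84\<close> if \<open>h = 0\<close>, and genus \<open>p + 1\<close> with
  \<open>p = 179\<close> then gives a group \<open>G\<close> of order \<open>k p\<close>. Its subgroup of order \<open>p\<close> is normal, and as
  \<open>(p - 1) / 2 = 89\<close> is a prime larger than \<open>k\<close>, conjugation by \<open>G\<close> is a sign on it. If \<open>h = 0\<close>, then
  a transfer argument shows that at least four of the generators have sign \<open>-1\<close>; their orders are
  even. Besides the two signatures of the theorem, only permutations of \<open>(2,2,4,4)\<close>, \<open>(2,2,2,4)\<close> and
  \<open>(2,2,2,6)\<close> pass the arithmetic then, and these fail for group-theoretic reasons. If \<open>h = 1\<close>, then
  \<open>r = 1\<close> would require a nonabelian group of order at most 4.
\<close>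

section \<open>Groups of order \<open>k p\<close> with \<open>k < p\<close>\<close>

text \<open>By Fermat the multiplicative order of \<open>e\<close> modulo \<open>p\<close> divides
  \<open>p - 1\<close> as well as \<open>m\<close>, hence divides 2, so that \<open>p\<close>
  divides \<open>(e - 1) * (e + 1)\<close>.\<close>

lemma cong_pm1_of_power_cong_1:
  fixes e :: int
  assumes p: "prime (p::nat)" and m: "m > 0" "[e ^ m = 1] (mod int p)" and d: "gcd m (p - 1) dvd 2"
  shows "[e = 1] (mod int p) \<or> [e = - 1] (mod int p)"
proof -
  define a where "a = nat (e mod int p)"
  have p0: "p > 0" using p prime_gt_0_nat by blast
  have a: "[int a = e] (mod int p)" using p0 by (simp add: a_def cong_def)
  have "[int a ^ m = 1] (mod int p)" using cong_pow[OF a, of m] m(2) cong_trans by blast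
  then have am: "[a ^ m = 1] (mod p)" by (simp flip: cong_int_iff)
  have "coprime (a ^ m) p" using cong_imp_coprime[OF cong_sym[OF am]] by simp
  then have "coprime a p" using m(1) by simp
  then have "[a ^ (p - 1) = 1] (mod p)" using fermat_theorem[OF p]
    by (metis coprime_absorb_left coprime_commute not_prime_unit p prime_imp_coprime)
  then have "[a ^ gcd m (p - 1) = 1] (mod p)" using am
    unfolding ord_divides by (rule gcd_greatest[rotated])
  then have "[a ^ 2 = 1] (mod p)" using d ord_divides dvd_trans by metis
  then have "[int a ^ 2 = 1] (mod int p)" by (simp flip: cong_int_iff)
  then have "int p dvd (int a - 1) * (int a + 1)"
    by (simp add: cong_iff_dvd_diff algebra_simps power2_eq_square)
  then have "int p dvd int a - 1 \<or> int p dvd int a + 1"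
    using p prime_dvd_mult_iff[of "int p"] by simp
  then have "[int a = 1] (mod int p) \<or> [int a = -1] (mod int p)"
    by (auto simp: cong_iff_dvd_diff)
  then show ?thesis using a cong_sym cong_trans by blast
qed

text \<open>Pigeonhole: the products \<open>z [^] i \<otimes> w [^] j\<close> with reduced exponents
  cannot be distinct in a group of order less than \<open>p * p\<close>. A coincidence makes a power
  of \<open>w\<close> with exponent prime to \<open>p\<close> a power of \<open>z\<close>. So the
  subgroup of order \<open>p\<close> is unique, hence normal.\<close>

lemma (in group) prime_order_in_same_subgroup:
  assumes fin: "finite (carrier G)" and o: "order G = k * p" "k < p" and p: "prime p"
    and z: "z \<in> carrier G" "ord z = p" and w: "w \<in> carrier G" "ord w = p"
  shows "\<exists>i::int. w = z [^] i"
proof -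
  define F where "F = (\<lambda>(i::int, j::int). z [^] i \<otimes> w [^] j)"
  let ?A = "{0..<int p} \<times> {0..<int p}"
  have "F ` ?A \<subseteq> carrier G" using z w by (auto simp: F_def)
  then have "card (F ` ?A) \<le> k * p" using fin o by (metis card_mono order_def)
  also have "\<dots> < p * p" using o(2) by simp
  also have "\<dots> = card ?A" by simp
  finally have "\<not> inj_on F ?A" by (metis card_image less_irrefl)
  then obtain i j i' j' where ij: "(i, j) \<in> ?A" "(i', j') \<in> ?A" "F (i, j) = F (i', j')" "(i, j) \<noteq> (i', j')"
    by (force simp: inj_on_def)
  have eq: "z [^] (i - i') = w [^] (j' - j)"
  proof -
    have "z [^] i \<otimes> w [^] j = z [^] i' \<otimes> w [^] j'" using ij(3) by (simp add: F_def)
    then have "z [^] (- i') \<otimes> (z [^] i \<otimes> w [^] j) \<otimes> w [^] (- j) =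
        z [^] (- i') \<otimes> (z [^] i' \<otimes> w [^] j') \<otimes> w [^] (- j)" by simp
    then have "(z [^] (- i') \<otimes> z [^] i) \<otimes> (w [^] j \<otimes> w [^] (- j)) =
        (z [^] (- i') \<otimes> z [^] i') \<otimes> (w [^] j' \<otimes> w [^] (- j))"
      using z(1) w(1) by (simp only: m_assoc m_closed int_pow_closed)
    then show ?thesis using z(1) w(1) by (simp flip: int_pow_mult)
  qed
  have "j \<noteq> j'"
  proof
    assume "j = j'"
    then have "int p dvd i - i'" using eq z int_pow_eq_id by simp
    then have "i = i'" using ij(1,2) zdvd_imp_le[of "int p" "i - i'"] zdvd_imp_le[of "int p" "i' - i"]
      by (smt (verit) atLeastLessThan_iff dvd_diff_commute mem_Sigma_iff)
    then show False using ij \<open>j = j'\<close> by simp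
  qed
  then have "\<not> int p dvd j' - j" using ij(1,2) zdvd_imp_le[of "int p" "j - j'"] zdvd_imp_le[of "int p" "j' - j"]
      by (smt (verit) atLeastLessThan_iff dvd_diff_commute mem_Sigma_iff)
  then have "coprime (j' - j) (int p)"
    using p prime_imp_coprime[of "int p" "j' - j"] coprime_commute by auto
  \<comment> \<open>Inverting the exponent modulo \<open>p\<close> turns the relation for a power of
    \<open>w\<close> into one for \<open>w\<close>.\<close>
  then obtain u where "[(j' - j) * u = 1] (mod int p)" using cong_solve_coprime_int by blast
  then have "w [^] ((j' - j) * u) = w [^] (1::int)" using w int_pow_eq
    by (metis cong_iff_dvd_diff cong_sym)
  then have "w = z [^] ((i - i') * u)" using w z eq by (metis int_pow_1 int_pow_pow)
  then show ?thesis ..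
qed

lemma (in group) int_pow_mod_order:
  assumes "x \<in> carrier G" "[i = j] (mod int (ord x))" shows "x [^] (i::int) = x [^] j"
  using assms int_pow_eq by (metis cong_iff_dvd_diff cong_sym)

lemma (in group) conj_int_pow:
  assumes "g \<in> carrier G" "z \<in> carrier G" "g \<otimes> z = z [^] (e::int) \<otimes> g"
  shows "g \<otimes> z [^] (i::int) = z [^] (e * i) \<otimes> g"
proof (induction i rule: int_induct[where k = 0])
  case base
  show ?case using assms by simp
next
  case (step1 i)
  have "g \<otimes> z [^] (i + 1) = (g \<otimes> z [^] i) \<otimes> z"
    using assms by (simp add: int_pow_mult m_assoc)
  also have "\<dots> = z [^] (e * i) \<otimes> (g \<otimes> z)" using assms step1 by (simp add: m_assoc)
  also have "\<dots> = z [^] (e * i + e) \<otimes> g" using assms by (simp add: int_pow_mult m_assoc)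
  finally show ?case by (simp add: algebra_simps)
next
  case (step2 i)
  have i: "z [^] (i - 1) \<otimes> z = z [^] i" using assms(2) int_pow_mult[of z "i - 1" 1] by simp
  have "(g \<otimes> z [^] (i - 1)) \<otimes> z = g \<otimes> z [^] i"
    using assms i by (simp add: m_assoc)
  also have "\<dots> = z [^] (e * (i - 1) + e) \<otimes> g" using step2 by (simp add: algebra_simps)
  also have "\<dots> = z [^] (e * (i - 1)) \<otimes> (g \<otimes> z)" using assms by (simp add: int_pow_mult m_assoc)
  also have "\<dots> = (z [^] (e * (i - 1)) \<otimes> g) \<otimes> z" using assms(1,2) by (simp add: m_assoc)
  finally show ?case using assms(1,2) by (metis int_pow_closed m_closed right_cancel)
qed

text \<open>Cauchy's theorem: Sylow's theorem with exponent 1 gives a subgroup of order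
  \<open>p\<close>, and any nontrivial element of it has order \<open>p\<close>.\<close>

lemma (in group) exists_ord_prime:
  assumes "finite (carrier G)" "order G = k * p" "prime p"
  shows "\<exists>z\<in>carrier G. ord z = p"
proof -
  have "order G = p ^ 1 * k" using assms by simp
  then obtain H where H: "subgroup H G" "card H = p"
    using sylow_thm[of p G 1 k] assms group_axioms by auto
  have "\<not> H \<subseteq> {\<one>}"
    using H(2) prime_gt_1_nat[OF assms(3)] card_mono[of "{\<one>}" H] by auto
  then obtain z where z: "z \<in> H" "z \<noteq> \<one>" by blast
  then have zG: "z \<in> carrier G" using H subgroup.subset by blast
  have "group (G\<lparr>carrier := H\<rparr>)" using H(1) group_axioms subgroup.subgroup_is_group by blast
  then have "z [^]\<^bsub>G\<lparr>carrier := H\<rparr>\<^esub> p = \<one>"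
    using group.pow_order_eq_1[of "G\<lparr>carrier := H\<rparr>" z] H z(1) by (simp add: order_def)
  then have "z [^] p = \<one>" using nat_pow_consistent by metis
  then have "ord z dvd p" using zG pow_eq_id by simp
  then have "ord z = p" using assms(3) zG z(2) ord_eq_1 prime_nat_iff by blast
  then show ?thesis using zG by blast
qed

text \<open>The conjugate of \<open>z\<close> has order \<open>p\<close>, so it is
  \<open>z [^] e\<close> for some \<open>e\<close>. Since \<open>g [^] (k * p) = \<one>\<close>, the
  power \<open>e ^ (k * p)\<close> is 1 modulo \<open>p\<close>, and the gcd condition leaves only
  \<open>e\<close> congruent to 1 or -1.\<close>

lemma (in group) conj_generator_of_order_prime:
  assumes fin: "finite (carrier G)" and o: "order G = k * p" "k < p" and p: "prime p"
    and d: "gcd (k * p) (p - 1) dvd 2"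
    and z: "z \<in> carrier G" "ord z = p" and g: "g \<in> carrier G"
  shows "g \<otimes> z = z \<otimes> g \<or> g \<otimes> z = inv z \<otimes> g"
proof -
  have inj: "ord (g \<otimes> z \<otimes> inv g) = p"
  proof -
    have "(g \<otimes> z \<otimes> inv g) [^] n = g \<otimes> z [^] n \<otimes> inv g" for n :: nat
    proof (induction n)
      case 0
      show ?case using g by simp
    next
      case (Suc n)
      have "(g \<otimes> z \<otimes> inv g) [^] Suc n = g \<otimes> z [^] n \<otimes> (inv g \<otimes> g) \<otimes> z \<otimes> inv g"
        using Suc g z(1) by (simp only: nat_pow_Suc m_assoc m_closed nat_pow_closed inv_closed)
      then show ?case using g z(1) by (simp add: m_assoc)
    qed
    moreover have "g \<otimes> x \<otimes> inv g = \<one> \<longleftrightarrow> x = \<one>" if "x \<in> carrier G" for x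
      using that g by (metis inv_closed l_cancel_one' m_closed inv_solve_right' l_one r_cancel_one')
    ultimately have "(g \<otimes> z \<otimes> inv g) [^] n = \<one> \<longleftrightarrow> p dvd n" for n :: nat
      using z pow_eq_id by simp
    then show ?thesis using g z(1) ord_unique by simp
  qed
  then obtain e :: int where "g \<otimes> z \<otimes> inv g = z [^] e"
    using prime_order_in_same_subgroup[OF fin o p z] g z(1) by (metis inv_closed m_closed)
  then have e: "g \<otimes> z = z [^] e \<otimes> g"
    using g z(1) by (metis inv_closed inv_solve_right' int_pow_closed m_closed)
  have iter: "g [^] n \<otimes> z = z [^] (e ^ n) \<otimes> g [^] n" for n :: nat
  proof (induction n)
    case 0
    show ?case using z by simp
  next
    case (Suc n)
    have "g [^] Suc n \<otimes> z = g [^] n \<otimes> (z [^] e \<otimes> g)" using g z(1) e by (simp add: m_assoc)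
    also have "\<dots> = (g [^] n \<otimes> z [^] e) \<otimes> g" using g z(1) by (simp add: m_assoc)
    also have "\<dots> = z [^] (e ^ n * e) \<otimes> g [^] n \<otimes> g"
      using conj_int_pow[OF _ z(1) Suc] g by simp
    finally show ?case using g z(1) by (simp add: m_assoc mult.commute)
  qed
  have "g [^] (k * p) = \<one>" using g o pow_order_eq_1 by metis
  then have "z = z [^] (e ^ (k * p))" using iter[of "k * p"] z(1) by simp
  then have "int p dvd e ^ (k * p) - 1" using z int_pow_eq[of z 1 "e ^ (k * p)"] by simp
  then have "[e ^ (k * p) = 1] (mod int p)" by (simp add: cong_iff_dvd_diff)
  moreover have "k * p > 0" using fin o by (metis order_gt_0_iff_finite)
  ultimately have "[e = 1] (mod int p) \<or> [e = -1] (mod int p)"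
    using cong_pm1_of_power_cong_1[OF p] d by blast
  then show ?thesis
    using int_pow_mod_order[of z e] z e by (metis int_pow_1 int_pow_neg)
qed

text \<open>
  Equivalently, \<open>G\<close> acts on the integers mod \<open>p\<close> by the affine maps \<open>v \<mapsto> \<epsilon> g v + f g\<close>, and \<open>z\<close> is a
  nontrivial translation.
\<close>

locale twisted_hom = group G for G (structure) +
  fixes p k :: nat and z :: 'a and \<epsilon> f :: "'a \<Rightarrow> int"
  assumes prime: "prime p" and odd: "odd p"
    and finite: "finite (carrier G)" and order: "order G = k * p"
    and z: "z \<in> carrier G" "ord z = p"
    and sign: "g \<in> carrier G \<Longrightarrow> \<epsilon> g = 1 \<or> \<epsilon> g = - 1"
    and sign_mult: "g \<in> carrier G \<Longrightarrow> h \<in> carrier G \<Longrightarrow> \<epsilon> (g \<otimes> h) = \<epsilon> g * \<epsilon> h"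
    and sign_z: "\<epsilon> z = 1"
    and conj: "g \<in> carrier G \<Longrightarrow> g \<otimes> z = z [^] \<epsilon> g \<otimes> g"
    and cross: "g \<in> carrier G \<Longrightarrow> h \<in> carrier G \<Longrightarrow> [f (g \<otimes> h) = f g + \<epsilon> g * f h] (mod int p)"
    and f_z: "\<not> int p dvd f z"

section \<open>Construction of the sign and of the twisted transfer\<close>

lemma (in group) exists_conj_sign:
  assumes fin: "finite (carrier G)" and o: "order G = k * p" "k < p" and p: "prime p" "odd p"
    and d: "gcd (k * p) (p - 1) dvd 2"
    and z: "z \<in> carrier G" "ord z = p"
  obtains \<epsilon> :: "'a \<Rightarrow> int" where
    "\<And>g. g \<in> carrier G \<Longrightarrow> \<epsilon> g = 1 \<or> \<epsilon> g = - 1"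
    "\<And>g h. g \<in> carrier G \<Longrightarrow> h \<in> carrier G \<Longrightarrow> \<epsilon> (g \<otimes> h) = \<epsilon> g * \<epsilon> h"
    "\<epsilon> z = 1"
    "\<And>g. g \<in> carrier G \<Longrightarrow> g \<otimes> z = z [^] \<epsilon> g \<otimes> g"
proof
  define \<epsilon> where "\<epsilon> = (\<lambda>g. if g \<otimes> z = z \<otimes> g then 1 else - 1 :: int)"
  show s: "\<epsilon> g = 1 \<or> \<epsilon> g = - 1" for g by (simp add: \<epsilon>_def)
  show "\<epsilon> z = 1" by (simp add: \<epsilon>_def)
  show c: "g \<otimes> z = z [^] \<epsilon> g \<otimes> g" if "g \<in> carrier G" for g
    using conj_generator_of_order_prime[OF fin o p(1) d z that] z(1)
    by (auto simp: \<epsilon>_def int_pow_neg)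
  \<comment> \<open>As \<open>p\<close> is odd, 1 and -1 are distinct exponents of \<open>z\<close>,
    so the conjugation relation determines the sign. Multiplicativity follows by comparing two such
    relations for \<open>g \<otimes> h\<close>.\<close>
  have uniq: "a = b" if "g \<otimes> z = z [^] a \<otimes> g" "g \<otimes> z = z [^] b \<otimes> g" "g \<in> carrier G"
      "a = 1 \<or> a = - 1" "b = 1 \<or> b = - 1" for g and a b :: int
  proof -
    have "z [^] a = z [^] b" using that z(1) by (metis int_pow_closed right_cancel)
    then have "int p dvd b - a" using z int_pow_eq by simp
    moreover have "\<not> int p dvd 2" "\<not> int p dvd - 2"
      using p zdvd_imp_le[of "int p" 2] prime_gt_1_nat[of p] by (cases "p = 2"; force)+
    ultimately show ?thesis using that(4,5) by auto
  qed
  show "\<epsilon> (g \<otimes> h) = \<epsilon> g * \<epsilon> h" if gh: "g \<in> carrier G" "h \<in> carrier G" for g h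
  proof (rule uniq)
    show "g \<otimes> h \<otimes> z = z [^] \<epsilon> (g \<otimes> h) \<otimes> (g \<otimes> h)" using c gh by simp
    have "g \<otimes> h \<otimes> z = g \<otimes> z [^] \<epsilon> h \<otimes> h" using c[OF gh(2)] gh z(1) by (simp add: m_assoc)
    also have "\<dots> = z [^] (\<epsilon> g * \<epsilon> h) \<otimes> g \<otimes> h" using conj_int_pow[OF gh(1) z(1) c[OF gh(1)]] by simp
    finally show "g \<otimes> h \<otimes> z = z [^] (\<epsilon> g * \<epsilon> h) \<otimes> (g \<otimes> h)" using gh z(1) by (simp add: m_assoc)
  qed (use gh s[of g] s[of h] s[of "g \<otimes> h"] in auto)
qed

text \<open>\<open>t\<close> picks a representative of the coset of \<open>x\<close> under the
  powers of \<open>z\<close>, and \<open>l\<close> is an exponent leading from it to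
  \<open>x\<close>. The choice is made from the set \<open>S x\<close>, which depends only on the
  coset, so \<open>t\<close> is constant on cosets.\<close>

lemma (in group) exists_transversal:
  assumes z: "z \<in> carrier G"
  obtains t :: "'a \<Rightarrow> 'a" and l :: "'a \<Rightarrow> int" where
    "\<And>x. x \<in> carrier G \<Longrightarrow> t x \<in> carrier G"
    "\<And>x. x \<in> carrier G \<Longrightarrow> x = z [^] l x \<otimes> t x"
    "\<And>x i. x \<in> carrier G \<Longrightarrow> t (z [^] (i::int) \<otimes> x) = t x"
    "\<And>x. x \<in> carrier G \<Longrightarrow> t (t x) = t x"
proof
  define S where "S = (\<lambda>x. range (\<lambda>i::int. z [^] i \<otimes> x))"
  define t where "t = (\<lambda>x. SOME y. y \<in> S x)"
  define l where "l = (\<lambda>x. SOME i::int. x = z [^] i \<otimes> t x)"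
  have tS: "t x \<in> S x" for x unfolding t_def by (rule someI_ex) (auto simp: S_def)
  have SS: "S (z [^] (i::int) \<otimes> x) = S x" if x: "x \<in> carrier G" for x i
  proof -
    have 1: "z [^] j \<otimes> (z [^] i \<otimes> x) = z [^] (j + i) \<otimes> x" for j
      using x z by (simp add: m_assoc int_pow_mult)
    have 2: "z [^] j \<otimes> x = z [^] (j - i) \<otimes> (z [^] i \<otimes> x)" for j
      using x z int_pow_mult[of z "j - i" i] by (simp flip: m_assoc)
    show ?thesis
    proof
      show "S (z [^] i \<otimes> x) \<subseteq> S x" unfolding S_def using 1 by (simp add: image_subset_iff)
      show "S x \<subseteq> S (z [^] i \<otimes> x)" unfolding S_def using 2 by (metis (lifting) image_subsetI rangeI)
    qed
  qed
  show tc: "t x \<in> carrier G" if "x \<in> carrier G" for x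
    using tS[of x] that z by (auto simp: S_def)
  show xt: "x = z [^] l x \<otimes> t x" if x: "x \<in> carrier G" for x
  proof -
    obtain i :: int where i: "t x = z [^] i \<otimes> x" using tS[of x] by (auto simp: S_def)
    have "z [^] (- i) \<otimes> t x = z [^] (- i + i) \<otimes> x"
      unfolding i int_pow_mult[OF z] using x z by (simp only: m_assoc int_pow_closed)
    then have "x = z [^] (- i) \<otimes> t x" using x by simp
    then show ?thesis unfolding l_def by (rule someI)
  qed
  show tz: "t (z [^] (i::int) \<otimes> x) = t x" if "x \<in> carrier G" for x i
    using SS[OF that] by (simp add: t_def)
  show "t (t x) = t x" if "x \<in> carrier G" for x
    using tz[OF tc[OF that], of "l x"] xt[OF that] by simp
qed

text \<open>
  The map \<open>f\<close> is a twisted transfer: the sum over a transversal \<open>T\<close> of the subgroup generated by \<open>z\<close>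
  of the exponents \<open>l\<close> with \<open>g x = z\<^sup>l y\<close> for \<open>x, y \<in> T\<close>.
\<close>

lemma (in group) exists_twisted_hom:
  assumes fin: "finite (carrier G)" and o: "order G = k * p" "k < p" and p: "prime p" "odd p"
    and d: "gcd (k * p) (p - 1) dvd 2"
  shows "\<exists>z \<epsilon> f. twisted_hom G p k z \<epsilon> f"
proof -
  obtain z where z: "z \<in> carrier G" "ord z = p" using exists_ord_prime[OF fin o(1) p(1)] by blast
  obtain \<epsilon> :: "'a \<Rightarrow> int" where
    s: "\<And>g. g \<in> carrier G \<Longrightarrow> \<epsilon> g = 1 \<or> \<epsilon> g = - 1" and
    sm: "\<And>g h. g \<in> carrier G \<Longrightarrow> h \<in> carrier G \<Longrightarrow> \<epsilon> (g \<otimes> h) = \<epsilon> g * \<epsilon> h" and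
    sz: "\<epsilon> z = 1" and
    c: "\<And>g. g \<in> carrier G \<Longrightarrow> g \<otimes> z = z [^] \<epsilon> g \<otimes> g"
    using exists_conj_sign[OF fin o p d z] by blast
  obtain t :: "'a \<Rightarrow> 'a" and l :: "'a \<Rightarrow> int" where
    tc: "\<And>x. x \<in> carrier G \<Longrightarrow> t x \<in> carrier G" and
    xt: "\<And>x. x \<in> carrier G \<Longrightarrow> x = z [^] l x \<otimes> t x" and
    tz: "\<And>x i. x \<in> carrier G \<Longrightarrow> t (z [^] (i::int) \<otimes> x) = t x" and
    tt: "\<And>x. x \<in> carrier G \<Longrightarrow> t (t x) = t x"
    using exists_transversal[OF z(1)] by blast
  define T where "T = t ` carrier G"
  define f where "f = (\<lambda>g. \<Sum>x\<in>T. l (g \<otimes> x))"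
  have TG: "x \<in> carrier G" "t x = x" if "x \<in> T" for x using that tc tt by (auto simp: T_def)
  have finT: "finite T" using fin by (simp add: T_def)
  have can: "[i = j] (mod int p)" if "z [^] i \<otimes> y = z [^] j \<otimes> y" "y \<in> carrier G" for i j :: int and y
  proof -
    have "z [^] i = z [^] j" using that z(1) by (metis int_pow_closed right_cancel)
    then show ?thesis using z int_pow_eq[of z i j] by (metis cong_iff_dvd_diff cong_sym)
  qed
  \<comment> \<open>Every element is \<open>z [^] i \<otimes> x\<close> for exactly one
    \<open>x\<close> in \<open>T\<close> and one reduced exponent \<open>i\<close>, so
    \<open>k * p = p * card T\<close>.\<close>
  have cardT: "card T = k"
  proof -
    define F where "F = (\<lambda>(i::int, x). z [^] i \<otimes> x)"
    let ?A = "{0..<int p} \<times> T"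
    have "inj_on F ?A"
    proof (rule inj_onI, clarify)
      fix i x j y assume *: "i \<in> {0..<int p}" "j \<in> {0..<int p}" "x \<in> T" "y \<in> T" "F (i, x) = F (j, y)"
      then have "t (z [^] i \<otimes> x) = t (z [^] j \<otimes> y)" by (simp add: F_def)
      then have "x = y" using tz TG * by metis
      moreover have "i = j" using can[of i x j] * \<open>x = y\<close> TG by (auto simp: F_def cong_def)
      ultimately show "i = j \<and> x = y" by simp
    qed
    moreover have "F ` ?A = carrier G"
    proof
      show "F ` ?A \<subseteq> carrier G" using z(1) TG by (auto simp: F_def)
      show "carrier G \<subseteq> F ` ?A"
      proof
        fix x assume x: "x \<in> carrier G"
        have "z [^] l x = z [^] (l x mod int p)"
          by (rule int_pow_mod_order) (use z in \<open>auto simp: cong_def\<close>)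
        then have "x = F (l x mod int p, t x)" using xt[OF x] by (simp add: F_def)
        moreover have "(l x mod int p, t x) \<in> ?A" using x p(1) prime_gt_0_nat by (auto simp: T_def)
        ultimately show "x \<in> F ` ?A" by blast
      qed
    qed
    ultimately have "order G = card ?A" by (metis card_image order_def)
    then have "k * p = p * card T" using o by (simp add: card_cartesian_product)
    then show ?thesis using p(1) prime_gt_0_nat by force
  qed
  have "twisted_hom G p k z \<epsilon> f"
  proof unfold_locales
    show "prime p" "odd p" "finite (carrier G)" "order G = k * p" "z \<in> carrier G" "ord z = p" "\<epsilon> z = 1"
      using assms z sz by auto
    show "\<epsilon> g = 1 \<or> \<epsilon> g = - 1" "g \<otimes> z = z [^] \<epsilon> g \<otimes> g" if "g \<in> carrier G" for g
      using that s c by auto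
    show "\<epsilon> (g \<otimes> h) = \<epsilon> g * \<epsilon> h" if "g \<in> carrier G" "h \<in> carrier G" for g h using that sm by auto
    show "[f (g \<otimes> h) = f g + \<epsilon> g * f h] (mod int p)" if gh: "g \<in> carrier G" "h \<in> carrier G" for g h
    proof -
      \<comment> \<open>The powers of \<open>z\<close> form a normal subgroup, so left
        multiplication by \<open>h\<close> permutes its cosets; \<open>u\<close> is the induced
        permutation of the representatives.\<close>
      define u where "u = (\<lambda>x. t (h \<otimes> x))"
      have uT: "u ` T \<subseteq> T" using TG(1) gh by (auto simp: u_def T_def)
      have "inj_on u T"
      proof (rule inj_onI)
        fix x y assume xy: "x \<in> T" "y \<in> T" "u x = u y"
        let ?a = "l (h \<otimes> x)" let ?b = "l (h \<otimes> y)"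
        have G: "x \<in> carrier G" "y \<in> carrier G" using TG xy by auto
        have y: "t (h \<otimes> y) = z [^] (- ?b) \<otimes> (h \<otimes> y)"
        proof -
          have "z [^] (- ?b) \<otimes> (z [^] ?b \<otimes> t (h \<otimes> y)) = z [^] (- ?b + ?b) \<otimes> t (h \<otimes> y)"
            unfolding int_pow_mult[OF z(1)] using G gh z(1) tc by (simp only: m_assoc int_pow_closed m_closed)
          then show ?thesis using xt[of "h \<otimes> y"] G gh tc by simp
        qed
        have "h \<otimes> x = z [^] ?a \<otimes> (z [^] (- ?b) \<otimes> (h \<otimes> y))"
          using xt[of "h \<otimes> x"] G gh xy(3) y by (simp add: u_def)
        also have "\<dots> = z [^] (?a - ?b) \<otimes> (h \<otimes> y)"
          using G gh z(1) int_pow_mult[of z ?a "- ?b"] by (simp flip: m_assoc)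
        finally have "x = inv h \<otimes> (z [^] (?a - ?b) \<otimes> (h \<otimes> y))"
          using G gh z(1) by (metis int_pow_closed inv_solve_left m_closed)
        also have "\<dots> = (inv h \<otimes> z [^] (?a - ?b)) \<otimes> (h \<otimes> y)" using G gh z(1) by (simp add: m_assoc)
        also have "\<dots> = z [^] (\<epsilon> (inv h) * (?a - ?b)) \<otimes> inv h \<otimes> (h \<otimes> y)"
          using conj_int_pow[of "inv h" z] c[of "inv h"] z(1) gh(2) by (metis inv_closed)
        also have "\<dots> = z [^] (\<epsilon> (inv h) * (?a - ?b)) \<otimes> ((inv h \<otimes> h) \<otimes> y)"
          using G gh z(1) by (simp only: m_assoc inv_closed m_closed int_pow_closed)
        also have "\<dots> = z [^] (\<epsilon> (inv h) * (?a - ?b)) \<otimes> y" using G gh by simp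
        finally have "t x = t y" using tz[OF G(2)] by metis
        then show "x = y" using TG xy by simp
      qed
      then have bij: "bij_betw u T T"
        using uT finT by (simp add: bij_betw_def endo_inj_surj)
      \<comment> \<open>Moving \<open>g\<close> past the power of \<open>z\<close> in
        \<open>h \<otimes> x\<close> multiplies its exponent by \<open>\<epsilon> g\<close>. Summed
        over \<open>T\<close> and reindexed by \<open>u\<close>, this is the twisted additivity of
        \<open>f\<close>.\<close>
      have "[l (g \<otimes> h \<otimes> x) = l (g \<otimes> u x) + \<epsilon> g * l (h \<otimes> x)] (mod int p)" if x: "x \<in> T" for x
      proof -
        have G: "x \<in> carrier G" "u x \<in> carrier G" using TG x uT by auto
        let ?e = "\<epsilon> g * l (h \<otimes> x)"
        have "g \<otimes> h \<otimes> x = g \<otimes> (z [^] l (h \<otimes> x) \<otimes> u x)"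
          using xt[of "h \<otimes> x"] G gh by (simp add: u_def m_assoc)
        also have "\<dots> = (g \<otimes> z [^] l (h \<otimes> x)) \<otimes> u x" using G gh z(1) by (simp add: m_assoc)
        also have "\<dots> = z [^] ?e \<otimes> g \<otimes> u x" using conj_int_pow[OF gh(1) z(1) c[OF gh(1)]] by simp
        finally have 1: "g \<otimes> h \<otimes> x = z [^] ?e \<otimes> (g \<otimes> u x)" using G gh z(1) by (simp add: m_assoc)
        then have 2: "t (g \<otimes> h \<otimes> x) = t (g \<otimes> u x)" using tz G gh by simp
        have "z [^] l (g \<otimes> h \<otimes> x) \<otimes> t (g \<otimes> u x) = z [^] ?e \<otimes> (z [^] l (g \<otimes> u x) \<otimes> t (g \<otimes> u x))"
          using xt[of "g \<otimes> h \<otimes> x", unfolded 2] xt[of "g \<otimes> u x"] 1 G gh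
          by (metis m_closed)
        also have "\<dots> = z [^] (?e + l (g \<otimes> u x)) \<otimes> t (g \<otimes> u x)"
          using G gh z(1) tc by (simp add: int_pow_mult m_assoc)
        finally have "[l (g \<otimes> h \<otimes> x) = ?e + l (g \<otimes> u x)] (mod int p)"
          using can tc G gh by simp
        then show ?thesis by (simp add: add.commute)
      qed
      then have "[f (g \<otimes> h) = (\<Sum>x\<in>T. l (g \<otimes> u x) + \<epsilon> g * l (h \<otimes> x))] (mod int p)"
        unfolding f_def by (rule cong_sum)
      also have "(\<Sum>x\<in>T. l (g \<otimes> u x) + \<epsilon> g * l (h \<otimes> x)) = f g + \<epsilon> g * f h"
        using sum.reindex_bij_betw[OF bij, of "\<lambda>x. l (g \<otimes> x)"]
        by (simp add: sum.distrib f_def sum_distrib_left)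
      finally show ?thesis .
    qed
    show "\<not> int p dvd f z"
    proof
      \<comment> \<open>\<open>z \<otimes> x\<close> has representative \<open>x\<close> and
        exponent 1, so \<open>f z\<close> is congruent to the number \<open>k\<close> of
        representatives, and \<open>0 < k < p\<close>.\<close>
      have "[l (z \<otimes> x) = 1] (mod int p)" if x: "x \<in> T" for x
      proof -
        have "t (z \<otimes> x) = x" using tz[of x 1] TG x z(1) by simp
        then have "z [^] (1::int) \<otimes> x = z [^] l (z \<otimes> x) \<otimes> x" using xt[of "z \<otimes> x"] TG x z(1) by simp
        then show ?thesis using can TG x cong_sym by blast
      qed
      then have "[f z = (\<Sum>x\<in>T. 1)] (mod int p)" unfolding f_def by (rule cong_sum)
      then have k: "[f z = int k] (mod int p)" by (simp add: cardT)
      assume "int p dvd f z"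
      then have "p dvd k" using cong_dvd_iff[OF k] by simp
      moreover have "k > 0" using fin o(1) order_gt_0_iff_finite by (metis nat_0_less_mult_iff)
      ultimately show False using o(2) dvd_imp_le by fastforce
    qed
  qed
  then show ?thesis by blast
qed

section \<open>Generators of sign \<open>-1\<close>\<close>

lemma (in monoid) list_prod_closed [simp]:
  "set xs \<subseteq> carrier G \<Longrightarrow> list_prod G xs \<in> carrier G"
  by (induction xs) (auto simp: list_prod_def)

lemma list_prod_Nil [simp]: "list_prod G [] = \<one>\<^bsub>G\<^esub>"
  and list_prod_Cons [simp]: "list_prod G (x # xs) = x \<otimes>\<^bsub>G\<^esub> list_prod G xs"
  by (simp_all add: list_prod_def)

lemma (in monoid) list_prod_append:
  "set xs \<subseteq> carrier G \<Longrightarrow> set ys \<subseteq> carrier G \<Longrightarrow>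
    list_prod G (xs @ ys) = list_prod G xs \<otimes> list_prod G ys"
  by (induction xs) (auto simp: m_assoc)

lemma (in group) subgroup_list_prod:
  "subgroup K G \<Longrightarrow> set xs \<subseteq> K \<Longrightarrow> list_prod G xs \<in> K"
  by (induction xs) (auto simp: subgroup.m_closed subgroup.one_closed)

text \<open>If a single entry lies outside \<open>K\<close>, the relation writes it as a product of
  inverses of elements of \<open>K\<close>.\<close>

lemma (in group) subset_subgroup_if_list_prod_eq_one:
  assumes K: "subgroup K G" and cs: "set cs \<subseteq> carrier G" "list_prod G cs = \<one>"
    and len: "length (filter (\<lambda>c. c \<notin> K) cs) \<le> 1"
  shows "set cs \<subseteq> K"
proof (cases "filter (\<lambda>c. c \<notin> K) cs")
  case Nil
  then show ?thesis by (auto simp: filter_empty_conv)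
next
  case (Cons b bs)
  then have "filter (\<lambda>c. c \<notin> K) cs = [b]" using len by simp
  then obtain us vs where d: "cs = us @ b # vs" "\<forall>u\<in>set us. u \<in> K" "b \<notin> K" "filter (\<lambda>c. c \<notin> K) vs = []"
    by (auto simp: filter_eq_Cons_iff)
  then have v: "\<forall>v\<in>set vs. v \<in> K" by (auto simp: filter_empty_conv)
  let ?u = "list_prod G us" let ?v = "list_prod G vs"
  have uv: "?u \<in> K" "?v \<in> K" using d v subgroup_list_prod[OF K] by blast+
  have c: "?u \<in> carrier G" "?v \<in> carrier G" "b \<in> carrier G" using cs d by auto
  have "?u \<otimes> (b \<otimes> ?v) = \<one>" using cs d by (auto simp: list_prod_append)
  then have "b \<otimes> ?v = inv ?u" using c by (metis inv_equality inv_inv m_closed inv_unique' inv_comm)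
  then have "b = inv ?u \<otimes> inv ?v" using c by (metis inv_closed inv_solve_right)
  then have "b \<in> K" using uv K by (simp add: subgroup.m_closed subgroup.m_inv_closed)
  then show ?thesis using d by simp
qed

text \<open>When the powers of \<open>z\<close> form a normal subgroup, these products form the
  subgroup generated by \<open>y\<close> and \<open>z\<close>.\<close>

definition cyclic_ext :: "('a, 'b) monoid_scheme \<Rightarrow> 'a \<Rightarrow> 'a \<Rightarrow> 'a set" where
  "cyclic_ext G y z = {y [^]\<^bsub>G\<^esub> i \<otimes>\<^bsub>G\<^esub> z [^]\<^bsub>G\<^esub> j | (i::int) (j::int). True}"

section \<open>Signs and point stabilizers\<close>

context twisted_hom
begin

lemma sign_one [simp]: "\<epsilon> \<one> = 1"
  using sign_mult[of \<one> \<one>] sign[of \<one>] by auto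

lemma sign_sq: "g \<in> carrier G \<Longrightarrow> \<epsilon> g * \<epsilon> g = 1"
  using sign[of g] by auto

lemma sign_pow: "g \<in> carrier G \<Longrightarrow> \<epsilon> (g [^] (n::nat)) = \<epsilon> g ^ n"
  by (induction n) (simp_all add: sign_mult mult.commute)

lemma even_ord:
  assumes "g \<in> carrier G" "\<epsilon> g = - 1" shows "even (ord g)"
proof -
  have "(- 1 :: int) ^ ord g = 1" using sign_pow[of g "ord g"] assms by simp
  then show ?thesis by (metis neg_one_odd_power one_neq_neg_one)
qed

lemma sign_list_prod:
  "set cs \<subseteq> carrier G \<Longrightarrow> \<epsilon> (list_prod G cs) = (- 1) ^ length (filter (\<lambda>c. \<epsilon> c = - 1) cs)"
proof (induction cs)
  case (Cons c cs)
  then show ?case using sign[of c] by (auto simp: sign_mult)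
qed simp

text \<open>The stabilizer of the point \<open>\<beta>\<close> under the affine action of the locale.\<close>

definition point_stabilizer :: "int \<Rightarrow> 'a set" where
  "point_stabilizer \<beta> = {g \<in> carrier G. int p dvd f g - \<beta> * (1 - \<epsilon> g)}"

text \<open>Subtracting the coboundary \<open>\<beta> * (1 - \<epsilon> g)\<close> from
  \<open>f g\<close> leaves a function with the same twisted additivity. If it vanishes at
  \<open>g\<close> modulo \<open>p\<close>, its value at \<open>g \<otimes> h\<close> is, up to
  sign, its value at \<open>h\<close>.\<close>

lemma point_stabilizer_mult:
  assumes "g \<in> carrier G" "h \<in> carrier G" "g \<in> point_stabilizer \<beta>"
  shows "g \<otimes> h \<in> point_stabilizer \<beta> \<longleftrightarrow> h \<in> point_stabilizer \<beta>"
proof -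
  have eq: "(f g + \<epsilon> g * f h) - \<beta> * (1 - \<epsilon> (g \<otimes> h)) =
      (f g - \<beta> * (1 - \<epsilon> g)) + \<epsilon> g * (f h - \<beta> * (1 - \<epsilon> h))"
    using assms by (simp add: sign_mult algebra_simps)
  have "int p dvd f (g \<otimes> h) - (f g + \<epsilon> g * f h)"
    using cross assms by (simp add: cong_iff_dvd_diff)
  then have "g \<otimes> h \<in> point_stabilizer \<beta> \<longleftrightarrow> int p dvd (f g + \<epsilon> g * f h) - \<beta> * (1 - \<epsilon> (g \<otimes> h))"
    using assms dvd_add_right_iff[of "int p" "f (g \<otimes> h) - (f g + \<epsilon> g * f h)"
        "(f g + \<epsilon> g * f h) - \<beta> * (1 - \<epsilon> (g \<otimes> h))"]
    by (simp add: point_stabilizer_def)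
  also have "\<dots> \<longleftrightarrow> int p dvd \<epsilon> g * (f h - \<beta> * (1 - \<epsilon> h))"
    unfolding eq using assms by (simp add: point_stabilizer_def dvd_add_right_iff)
  also have "\<dots> \<longleftrightarrow> h \<in> point_stabilizer \<beta>" using sign[OF assms(1)] assms(2)
    by (auto simp: point_stabilizer_def dvd_diff_commute)
  finally show ?thesis .
qed

lemma one_in_point_stabilizer: "\<one> \<in> point_stabilizer \<beta>"
  using cross[of \<one> \<one>] by (simp add: point_stabilizer_def cong_iff_dvd_diff)

lemma subgroup_point_stabilizer: "subgroup (point_stabilizer \<beta>) G"
proof (rule subgroupI)
  show "point_stabilizer \<beta> \<subseteq> carrier G" by (auto simp: point_stabilizer_def)
  show "point_stabilizer \<beta> \<noteq> {}" using one_in_point_stabilizer by blast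
  show "g \<otimes> h \<in> point_stabilizer \<beta>" if "g \<in> point_stabilizer \<beta>" "h \<in> point_stabilizer \<beta>" for g h
    using that point_stabilizer_mult by (auto simp: point_stabilizer_def)
  show "inv g \<in> point_stabilizer \<beta>" if "g \<in> point_stabilizer \<beta>" for g
  proof -
    have g: "g \<in> carrier G" using that by (simp add: point_stabilizer_def)
    then show ?thesis using point_stabilizer_mult[OF g _ that, of "inv g"] one_in_point_stabilizer by simp
  qed
qed

lemma z_notin_point_stabilizer: "z \<notin> point_stabilizer \<beta>"
  using f_z by (simp add: point_stabilizer_def sign_z)

text \<open>On powers of an element of sign 1, \<open>f\<close> is additive modulo \<open>p\<close>.
  So \<open>ord c * f c\<close> is congruent to \<open>f \<one>\<close>, hence to 0, and
  \<open>ord c\<close> is invertible.\<close>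

lemma in_point_stabilizer_if_sign_1:
  assumes c: "c \<in> carrier G" "coprime (ord c) p" "\<epsilon> c = 1"
  shows "c \<in> point_stabilizer \<beta>"
proof -
  have "[f (c [^] n) = int n * f c] (mod int p)" for n :: nat
  proof (induction n)
    case 0
    show ?case using one_in_point_stabilizer[of 0] by (simp add: point_stabilizer_def cong_0_iff)
  next
    case (Suc n)
    have "[f (c [^] Suc n) = f (c [^] n) + f c] (mod int p)"
      using cross[of "c [^] n" c] c by (simp add: sign_pow)
    also have "[f (c [^] n) + f c = int n * f c + f c] (mod int p)" using Suc by (simp add: cong_add)
    finally show ?case by (simp add: algebra_simps)
  qed
  from this[of "ord c"] have "[f \<one> = int (ord c) * f c] (mod int p)" using c by simp
  moreover have "[f \<one> = 0] (mod int p)" using one_in_point_stabilizer[of 0] by (simp add: point_stabilizer_def cong_0_iff)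
  ultimately have "[int (ord c) * f c = 0] (mod int p)" using cong_trans[OF cong_sym] by blast
  then have "int p dvd int (ord c) * f c" by (simp add: cong_0_iff)
  then have "int p dvd f c" using c(2) by (simp add: coprime_commute coprime_dvd_mult_right_iff)
  then show ?thesis using c by (simp add: point_stabilizer_def)
qed

lemma exists_point_stabilizer:
  assumes "a \<in> carrier G" "\<epsilon> a = - 1" shows "\<exists>\<beta>. a \<in> point_stabilizer \<beta>"
proof -
  have "coprime 2 (int p)" using odd by simp
  \<comment> \<open>\<open>a\<close> acts as the reflection \<open>v \<mapsto> f a - v\<close>,
    whose fixed point is half of \<open>f a\<close>; \<open>u\<close> is the inverse of 2 modulo
    \<open>p\<close>.\<close>
  then obtain u where "[2 * u = 1] (mod int p)" using cong_solve_coprime_int by blast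
  then have "[2 * u * f a = 1 * f a] (mod int p)" by (rule cong_scalar_right)
  then have "int p dvd f a - (u * f a) * (1 - \<epsilon> a)"
    using assms by (simp add: cong_iff_dvd_diff dvd_diff_commute algebra_simps)
  then show ?thesis using assms by (auto simp: point_stabilizer_def)
qed

text \<open>
  An element of sign \<open>1\<close> and order prime to \<open>p\<close> is a translation of order prime to \<open>p\<close>, hence acts
  trivially, and an element of sign \<open>-1\<close> fixes a point. With at most two generators of sign \<open>-1\<close>,
  the relation makes all generators fix a common point, which \<open>z\<close> does not.
\<close>

lemma four_sign_changes:
  assumes cs: "set cs \<subseteq> carrier G" "generate G (set cs) = carrier G" "list_prod G cs = \<one>"
    and ord: "\<And>c. c \<in> set cs \<Longrightarrow> coprime (ord c) p"
  shows "4 \<le> length (filter (\<lambda>c. \<epsilon> c = - 1) cs)"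
proof (rule ccontr)
  let ?F = "filter (\<lambda>c. \<epsilon> c = - 1) cs"
  assume "\<not> 4 \<le> length ?F"
  \<comment> \<open>The product of all signs is the sign of \<open>\<one>\<close>, so the entries of
    sign -1 are even in number.\<close>
  moreover have "even (length ?F)"
    using sign_list_prod[OF cs(1)] cs(3) by (metis neg_one_odd_power one_neq_neg_one sign_one)
  ultimately have len: "length ?F \<le> 2" by presburger
  have sub: "\<not> set cs \<subseteq> point_stabilizer \<beta>" for \<beta>
    using generate_subgroup_incl[OF _ subgroup_point_stabilizer, of "set cs" \<beta>] cs(2) z(1) z_notin_point_stabilizer by blast
  have pos: "\<epsilon> c = - 1" if "c \<in> set cs" "c \<notin> point_stabilizer \<beta>" for c \<beta>
    using that in_point_stabilizer_if_sign_1 sign cs(1) ord by blast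
  show False
  proof (cases ?F)
    case Nil
    then show False using sub[of 0] pos[of _ 0] by (auto simp: filter_empty_conv)
  next
    case (Cons a bs)
    then have "a \<in> set ?F" by simp
    then obtain \<beta> where \<beta>: "a \<in> point_stabilizer \<beta>" using exists_point_stabilizer[of a] cs(1) by auto
    \<comment> \<open>Entries outside the stabilizer have sign -1. Of these at most two entries the
      first is \<open>a\<close>, which lies inside, so at most one is outside.\<close>
    have "filter (\<lambda>c. c \<notin> point_stabilizer \<beta>) cs = filter (\<lambda>c. c \<notin> point_stabilizer \<beta>) ?F"
      using pos[of _ \<beta>] by (auto simp: filter_filter intro!: filter_cong)
    also have "\<dots> = filter (\<lambda>c. c \<notin> point_stabilizer \<beta>) bs" using Cons \<beta> by simp
    finally have "length (filter (\<lambda>c. c \<notin> point_stabilizer \<beta>) cs) \<le> 1"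
      using len Cons by (metis One_nat_def Suc_le_mono length_Cons length_filter_le numeral_2_eq_2 order_trans)
    then show False using subset_subgroup_if_list_prod_eq_one[OF subgroup_point_stabilizer cs(1,3)] sub by blast
  qed
qed

section \<open>The subgroup generated by an element and \<open>z\<close>\<close>

lemma sign_int_pow: "g \<in> carrier G \<Longrightarrow> \<epsilon> (g [^] (i::int)) = \<epsilon> g ^ nat \<bar>i\<bar>"
proof -
  assume g: "g \<in> carrier G"
  have "\<epsilon> (inv h) = \<epsilon> h" if "h \<in> carrier G" for h
    using sign_mult[of h "inv h"] sign[of h] that by auto
  then have "\<epsilon> (inv (g [^] nat (- i))) = \<epsilon> g ^ nat (- i)" using g sign_pow by simp
  then show ?thesis using g sign_pow[of g "nat i"] by (cases "i < 0") (simp_all only: int_pow_def2 if_True if_False abs_if)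
qed

lemma z_pow_commute:
  assumes "g \<in> carrier G" shows "z [^] (j::int) \<otimes> g = g \<otimes> z [^] (\<epsilon> g * j)"
proof -
  have "g \<otimes> z [^] (\<epsilon> g * j) = z [^] (\<epsilon> g * \<epsilon> g * j) \<otimes> g"
    using conj_int_pow[OF assms z(1) conj[OF assms], of "\<epsilon> g * j"] by (simp add: mult.assoc)
  then show ?thesis using sign_sq[OF assms] by simp
qed

lemma cyclic_ext_mult:
  fixes i j i' j' :: int
  assumes y: "y \<in> carrier G"
  shows "(y [^] i \<otimes> z [^] j) \<otimes> (y [^] i' \<otimes> z [^] j') =
    y [^] (i + i') \<otimes> z [^] (\<epsilon> (y [^] i') * j + j')"
proof -
  have "(y [^] i \<otimes> z [^] j) \<otimes> (y [^] i' \<otimes> z [^] j') = y [^] i \<otimes> (z [^] j \<otimes> y [^] i') \<otimes> z [^] j'"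
    using y z(1) by (simp add: m_assoc)
  also have "\<dots> = y [^] i \<otimes> (y [^] i' \<otimes> z [^] (\<epsilon> (y [^] i') * j)) \<otimes> z [^] j'"
    using z_pow_commute[of "y [^] i'" j] y by simp
  finally show ?thesis using y z(1) by (simp add: m_assoc int_pow_mult)
qed

lemma subgroup_cyclic_ext:
  assumes y: "y \<in> carrier G" shows "subgroup (cyclic_ext G y z) G"
proof (rule subgroupI)
  show "cyclic_ext G y z \<subseteq> carrier G" using y z(1) by (auto simp: cyclic_ext_def)
  show "cyclic_ext G y z \<noteq> {}" by (auto simp: cyclic_ext_def)
  show "g \<otimes> h \<in> cyclic_ext G y z" if "g \<in> cyclic_ext G y z" "h \<in> cyclic_ext G y z" for g h
    using that unfolding cyclic_ext_def using cyclic_ext_mult[OF y] by force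
  show "inv g \<in> cyclic_ext G y z" if g: "g \<in> cyclic_ext G y z" for g
  proof -
    obtain i j :: int where ij: "g = y [^] i \<otimes> z [^] j" using g by (auto simp: cyclic_ext_def)
    \<comment> \<open>Chosen so that the exponent of \<open>z\<close> in the product formula
      \<open>cyclic_ext_mult\<close> cancels.\<close>
    let ?j' = "- (\<epsilon> (y [^] (- i)) * j)"
    have "g \<otimes> (y [^] (- i) \<otimes> z [^] ?j') = \<one>"
      unfolding ij cyclic_ext_mult[OF y] using y z by simp
    then have "inv g = y [^] (- i) \<otimes> z [^] ?j'"
      using y z(1) ij by (intro inv_equality) (auto intro: inv_comm)
    then show ?thesis by (auto simp: cyclic_ext_def)
  qed
qed

text \<open>As \<open>ord y\<close> and \<open>p\<close> are coprime, a power of \<open>y\<close>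
  equals a power of \<open>z\<close> only if both are \<open>\<one>\<close>, so the products with
  reduced exponents are distinct.\<close>

lemma card_cyclic_ext:
  assumes y: "y \<in> carrier G" and cop: "coprime (ord y) p"
  shows "ord y * p \<le> card (cyclic_ext G y z)"
proof -
  define F where "F = (\<lambda>(i::int, j::int). y [^] i \<otimes> z [^] j)"
  let ?A = "{0..<int (ord y)} \<times> {0..<int p}"
  have "inj_on F ?A"
  proof (rule inj_onI, clarify)
    fix i j i' j'
    assume *: "i \<in> {0..<int (ord y)}" "j \<in> {0..<int p}" "i' \<in> {0..<int (ord y)}" "j' \<in> {0..<int p}"
      and eq: "F (i, j) = F (i', j')"
    have "y [^] (- i') \<otimes> (y [^] i \<otimes> z [^] j) \<otimes> z [^] (- j) =
        y [^] (- i') \<otimes> (y [^] i' \<otimes> z [^] j') \<otimes> z [^] (- j)" using eq by (simp add: F_def)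
    then have "(y [^] (- i') \<otimes> y [^] i) \<otimes> (z [^] j \<otimes> z [^] (- j)) =
        (y [^] (- i') \<otimes> y [^] i') \<otimes> (z [^] j' \<otimes> z [^] (- j))"
      using z(1) y by (simp only: m_assoc m_closed int_pow_closed)
    then have e: "y [^] (i - i') = z [^] (j' - j)" using z(1) y by (simp flip: int_pow_mult)
    then have "y [^] ((i - i') * int p) = z [^] ((j' - j) * int p)"
      using z(1) y by (metis int_pow_pow)
    also have "\<dots> = \<one>" using z int_pow_eq_id by simp
    finally have "int (ord y) dvd (i - i') * int p" using y int_pow_eq_id by simp
    then have "int (ord y) dvd i - i'" using cop by (simp add: coprime_dvd_mult_left_iff)
    then have i: "i = i'" using *(1,3) by (metis atLeastLessThan_iff mod_eq_dvd_iff mod_pos_pos_trivial)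
    then have "int p dvd j' - j" using e i z int_pow_eq_id[of z "j' - j"] by simp
    then have "j' = j" using *(2,4) by (metis atLeastLessThan_iff mod_eq_dvd_iff mod_pos_pos_trivial)
    then show "i = i' \<and> j = j'" using i by simp
  qed
  then have "card (F ` ?A) = ord y * p" by (simp add: card_image card_cartesian_product)
  moreover have "F ` ?A \<subseteq> cyclic_ext G y z" by (auto simp: F_def cyclic_ext_def)
  moreover have "cyclic_ext G y z \<subseteq> carrier G" using y z(1) by (auto simp: cyclic_ext_def)
  ultimately show ?thesis using finite by (metis card_mono finite_subset)
qed

text \<open>Sign -1 forces an odd exponent \<open>i\<close> of \<open>y\<close> and makes the powers
  of \<open>z\<close> cancel in the square, so \<open>g \<otimes> g = y [^] (i + i)\<close>. This is
  not \<open>\<one>\<close>, as 4 divides \<open>ord y\<close> but not \<open>i + i\<close>.\<close>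

lemma involution_notin_cyclic_ext:
  assumes y: "y \<in> carrier G" "\<epsilon> y = - 1" "4 dvd ord y"
    and g: "\<epsilon> g = - 1" "ord g = 2"
  shows "g \<notin> cyclic_ext G y z"
proof
  assume "g \<in> cyclic_ext G y z"
  then obtain i j :: int where ij: "g = y [^] i \<otimes> z [^] j" by (auto simp: cyclic_ext_def)
  have gc: "g \<in> carrier G" using ij y z(1) by simp
  have "\<epsilon> g = \<epsilon> (y [^] i)" using ij y z(1) by (simp add: sign_mult sign_int_pow sign_z)
  then have s: "\<epsilon> (y [^] i) = - 1" using g by simp
  then have "odd (nat \<bar>i\<bar>)" using y sign_int_pow[of y i]
    by (metis neg_one_even_power one_neq_neg_one)
  then have "odd i" by (simp add: even_nat_iff)
  have "g \<otimes> g = \<one>" using pow_ord_eq_1[OF gc] g gc by (simp add: numeral_2_eq_2)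
  then have "y [^] (i + i) = \<one>" unfolding ij cyclic_ext_mult[OF y(1)] using s y by simp
  then have "int (ord y) dvd i + i" using y int_pow_eq_id by simp
  moreover have "int 4 dvd int (ord y)" using y(3) by (simp only: int_dvd_int_iff)
  ultimately have "4 dvd i + i" using dvd_trans by fastforce
  then show False using \<open>odd i\<close> by presburger
qed

end

section \<open>Subgroups of index at most two\<close>

lemma (in group) mult_in_subgroup_left:
  assumes H: "subgroup H G" and "a \<in> H" "b \<in> carrier G"
  shows "a \<otimes> b \<in> H \<longleftrightarrow> b \<in> H"
proof
  have a: "a \<in> carrier G" using assms subgroup.subset by blast
  assume "a \<otimes> b \<in> H"
  then have "inv a \<otimes> (a \<otimes> b) \<in> H" using assms by (simp only: subgroup.m_closed subgroup.m_inv_closed)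
  then show "b \<in> H" using a assms(3) by (simp flip: m_assoc)
qed (use assms in \<open>simp add: subgroup.m_closed\<close>)

lemma (in group) mult_in_subgroup_right:
  assumes H: "subgroup H G" and "b \<in> H" "a \<in> carrier G"
  shows "a \<otimes> b \<in> H \<longleftrightarrow> a \<in> H"
proof
  have b: "b \<in> carrier G" using assms subgroup.subset by blast
  assume "a \<otimes> b \<in> H"
  then have "a \<otimes> b \<otimes> inv b \<in> H" using assms by (simp only: subgroup.m_closed subgroup.m_inv_closed)
  then show "a \<in> H" using b assms(3) by (simp add: m_assoc)
qed (use assms in \<open>simp add: subgroup.m_closed\<close>)

text \<open>The cardinality bound says that \<open>H\<close> has index at most 2. So the coset of
  \<open>inv a\<close> fills the complement of \<open>H\<close>, and
  \<open>b = inv a \<otimes> h\<close> for some \<open>h\<close> in \<open>H\<close>.\<close>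

lemma (in group) mult_in_subgroup_of_large_card:
  assumes H: "subgroup H G" and fin: "finite (carrier G)" and card: "order G \<le> 2 * card H"
    and ab: "a \<in> carrier G" "b \<in> carrier G" "a \<notin> H" "b \<notin> H"
  shows "a \<otimes> b \<in> H"
proof -
  have HG: "H \<subseteq> carrier G" using H subgroup.subset by blast
  let ?m = "\<lambda>h. inv a \<otimes> h"
  have inj: "inj_on ?m H" using HG ab by (auto simp: inj_on_def subset_iff)
  have "?m ` H \<subseteq> carrier G - H"
  proof
    fix x assume "x \<in> ?m ` H"
    then obtain h where h: "h \<in> H" "x = inv a \<otimes> h" by blast
    have "x \<notin> H"
    proof
      assume "x \<in> H"
      moreover have "h = a \<otimes> x" using h HG ab(1) by (simp add: subset_iff flip: m_assoc)
      ultimately have "a \<in> H" using h(1) mult_in_subgroup_right[OF H] ab(1) by blast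
      then show False using ab by simp
    qed
    then show "x \<in> carrier G - H" using h HG ab by auto
  qed
  moreover have "card (carrier G - H) \<le> card (?m ` H)"
    using card HG fin by (simp add: card_image[OF inj] card_Diff_subset finite_subset order_def)
  ultimately have "?m ` H = carrier G - H" using fin by (simp add: card_seteq)
  then obtain h where h: "h \<in> H" "b = inv a \<otimes> h" using ab by blast
  then have "a \<otimes> b = h" using HG ab(1) by (simp add: subset_iff flip: m_assoc)
  then show ?thesis using h by simp
qed

text \<open>Membership in \<open>H\<close> behaves like a parity: each factor outside
  \<open>H\<close> switches it.\<close>

lemma (in group) list_prod_in_subgroup_of_large_card:
  assumes H: "subgroup H G" and fin: "finite (carrier G)" and card: "order G \<le> 2 * card H"
  shows "set cs \<subseteq> carrier G \<Longrightarrow> list_prod G cs \<in> H \<longleftrightarrow> even (length (filter (\<lambda>c. c \<notin> H) cs))"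
proof (induction cs)
  case Nil
  show ?case using H by (simp add: subgroup.one_closed)
next
  case (Cons c cs)
  let ?g = "list_prod G cs"
  have c: "c \<in> carrier G" "?g \<in> carrier G" using Cons by auto
  have 1: "c \<otimes> ?g \<in> H \<longleftrightarrow> ?g \<in> H" if "c \<in> H"
    using that c(2) mult_in_subgroup_left[OF H] by blast
  have 2: "c \<otimes> ?g \<in> H \<longleftrightarrow> ?g \<notin> H" if "c \<notin> H"
    using that c mult_in_subgroup_right[OF H] mult_in_subgroup_of_large_card[OF H fin card] by blast
  show ?case using Cons 1 2 by auto
qed

section \<open>Arithmetic of signatures\<close>

text \<open>The sum is the branching term of the Riemann-Hurwitz formula. Each summand lies between
  1/2 and 1, and is 1/2 only for \<open>m = 2\<close>.\<close>

lemma defect_bounds: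
  assumes "\<forall>m\<in>set ms. m \<ge> (2::nat)"
  shows "real (length ms) / 2 \<le> (\<Sum>m\<leftarrow>ms. 1 - 1 / real m)"
    and "(\<Sum>m\<leftarrow>ms. 1 - 1 / real m) \<le> real (length ms)"
    and "(\<Sum>m\<leftarrow>ms. 1 - 1 / real m) \<le> real (length ms) / 2 \<Longrightarrow> ms = replicate (length ms) 2"
  using assms
proof (induction ms)
  case (Cons m ms)
  define q where "q = 1 / real m"
  have q: "0 \<le> q" "q \<le> 1 / 2" if "m \<ge> 2" using that by (simp_all add: q_def field_simps)
  have sum: "(\<Sum>m\<leftarrow>m # ms. 1 - 1 / real m) = 1 - q + (\<Sum>m\<leftarrow>ms. 1 - 1 / real m)"
    "real (length (m # ms)) = 1 + real (length ms)" by (simp_all add: q_def)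
  { case 1 then show ?case unfolding sum using q Cons.IH(1) by auto }
  { case 2 then show ?case unfolding sum using q Cons.IH(2) by auto }
  { case 3
    then have "q = 1 / 2" "(\<Sum>m\<leftarrow>ms. 1 - 1 / real m) \<le> real (length ms) / 2"
      unfolding sum using q Cons.IH(1) by auto
    then show ?case using Cons.IH(3) 3 by (simp add: q_def field_simps) }
qed auto

section \<open>Lower bounds for the branching term\<close>

text \<open>The value 41/42 is attained at the Hurwitz triple (2,3,7). In the borderline cases the
  sum being below 1 pushes \<open>c\<close> past the Euclidean triples (3,3,3), (2,3,6) and
  (2,4,4).\<close>

lemma inverse_sum_gap_sorted:
  fixes a b c :: nat
  assumes "2 \<le> a" "a \<le> b" "b \<le> c" "1 / real a + 1 / real b + 1 / real c < 1"
  shows "1 / real a + 1 / real b + 1 / real c \<le> 41 / 42"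
proof -
  define A B C where "A = 1 / real a" and "B = 1 / real b" and "C = 1 / real c"
  have le: "a \<ge> n \<Longrightarrow> n > 0 \<Longrightarrow> A \<le> 1 / real n" "b \<ge> n \<Longrightarrow> n > 0 \<Longrightarrow> B \<le> 1 / real n"
    "c \<ge> n \<Longrightarrow> n > 0 \<Longrightarrow> C \<le> 1 / real n" "c \<le> n \<Longrightarrow> C \<ge> 1 / real n" for n :: nat
    using assms by (simp_all add: A_def B_def C_def frac_le)
  have eq: "a = n \<Longrightarrow> A = 1 / real n" "b = n \<Longrightarrow> B = 1 / real n" "c = n \<Longrightarrow> C = 1 / real n" for n
    by (simp_all add: A_def B_def C_def)
  have lt: "A + B + C < 1" "C > 0" using assms by (simp_all add: A_def B_def C_def)
  consider "a \<ge> 4" | "a = 3" "b = 3" | "a = 3" "b \<ge> 4" | "a = 2" "b = 2" | "a = 2" "b = 3"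
    | "a = 2" "b = 4" | "a = 2" "b \<ge> 5"
    using assms by linarith
  then have "A + B + C \<le> 41 / 42"
  proof cases
    case 1
    then show ?thesis using le(1)[of 4] le(2)[of 4] le(3)[of 4] assms by simp
  next
    case 2
    have "c \<noteq> 3" using 2 lt eq(1)[of 3] eq(2)[of 3] eq(3)[of 3] by auto
    then show ?thesis using 2 eq(1)[of 3] eq(2)[of 3] le(3)[of 4] assms by simp
  next
    case 3
    then show ?thesis using eq(1)[of 3] le(2)[of 4] le(3)[of 4] assms by simp
  next
    case 4
    then show ?thesis using eq(1)[of 2] eq(2)[of 2] lt by simp
  next
    case 5
    have "\<not> c \<le> 6" using 5 eq(1)[of 2] eq(2)[of 3] le(4)[of 6] lt by auto
    then show ?thesis using 5 eq(1)[of 2] eq(2)[of 3] le(3)[of 7] by simp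
  next
    case 6
    have "c \<noteq> 4" using 6 lt eq(1)[of 2] eq(2)[of 4] eq(3)[of 4] by auto
    then show ?thesis using 6 eq(1)[of 2] eq(2)[of 4] le(3)[of 5] assms by simp
  next
    case 7
    then show ?thesis using eq(1)[of 2] le(2)[of 5] le(3)[of 5] assms by simp
  qed
  then show ?thesis by (simp add: A_def B_def C_def)
qed

lemma inverse_sum_gap:
  fixes a b c :: nat
  assumes "2 \<le> a" "2 \<le> b" "2 \<le> c" "1 / real a + 1 / real b + 1 / real c < 1"
  shows "1 / real a + 1 / real b + 1 / real c \<le> 41 / 42"
  using assms inverse_sum_gap_sorted[of a b c] inverse_sum_gap_sorted[of a c b]
    inverse_sum_gap_sorted[of b a c] inverse_sum_gap_sorted[of b c a]
    inverse_sum_gap_sorted[of c a b] inverse_sum_gap_sorted[of c b a]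
    nat_le_linear[of a b] nat_le_linear[of b c] nat_le_linear[of a c]
  by (auto simp: add_ac)

lemma length_eq_3E:
  assumes "length xs = 3" obtains a b c where "xs = [a, b, c]"
  using assms by (auto simp: numeral_3_eq_3 length_Suc_conv)

lemma length_eq_4E:
  assumes "length xs = 4" obtains a b c d where "xs = [a, b, c, d]"
  using assms by (auto simp: eval_nat_numeral length_Suc_conv)

text \<open>Three summands are at least 1/2, and the one at \<open>x\<close> is at least
  \<open>1 - 1 / real n\<close>.\<close>

lemma defect_4_ge:
  assumes len: "length ms = 4" and m: "\<forall>m\<in>set ms. m \<ge> (2::nat)" "x \<in> set ms" "x \<ge> n" "n > 0"
  shows "(\<Sum>m\<leftarrow>ms. 1 - 1 / real m) \<ge> 5 / 2 - 1 / real n"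
proof -
  obtain a b c d where ms: "ms = [a, b, c, d]" using len by (rule length_eq_4E)
  define A B C D where "A = 1 / real a" and "B = 1 / real b" and "C = 1 / real c" and "D = 1 / real d"
  have le: "a \<ge> n \<Longrightarrow> n > 0 \<Longrightarrow> A \<le> 1 / real n" "b \<ge> n \<Longrightarrow> n > 0 \<Longrightarrow> B \<le> 1 / real n"
    "c \<ge> n \<Longrightarrow> n > 0 \<Longrightarrow> C \<le> 1 / real n" "d \<ge> n \<Longrightarrow> n > 0 \<Longrightarrow> D \<le> 1 / real n" for n :: nat
    by (simp_all add: A_def B_def C_def D_def frac_le)
  have "(\<Sum>m\<leftarrow>ms. 1 - 1 / real m) = 4 - A - B - C - D"
    by (simp add: ms A_def B_def C_def D_def)
  moreover have "A \<le> 1 / 2" "B \<le> 1 / 2" "C \<le> 1 / 2" "D \<le> 1 / 2"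
    using m(1) le[of 2] by (simp_all add: ms)
  moreover have "A \<le> 1 / real n \<or> B \<le> 1 / real n \<or> C \<le> 1 / real n \<or> D \<le> 1 / real n"
    using m(2-) le[of n] by (auto simp: ms)
  ultimately show ?thesis by linarith
qed

text \<open>Three entries reduce to the gap for reciprocals. Four entries equal to 2 would give
  exactly 2, so one of four is at least 3 and the sum at least 13/6. Five or more give at least
  5/2.\<close>

lemma defect_gap:
  assumes ms: "\<forall>m\<in>set ms. m \<ge> (2::nat)" and gt: "(\<Sum>m\<leftarrow>ms. 1 - 1 / real m) > 2"
  shows "(\<Sum>m\<leftarrow>ms. 1 - 1 / real m) \<ge> 2 + 1 / 42"
proof -
  have "length ms > 2" using defect_bounds(2)[OF ms] gt by linarith
  then consider "length ms = 3" | "length ms = 4" | "length ms \<ge> 5" by linarith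
  then show ?thesis
  proof cases
    case 1
    then obtain a b c where "ms = [a, b, c]" by (rule length_eq_3E)
    then show ?thesis using inverse_sum_gap[of a b c] ms gt by simp
  next
    case 2
    have "\<not> set ms \<subseteq> {2}"
    proof
      assume "set ms \<subseteq> {2}"
      then have "ms = replicate 4 2" using 2 by (metis replicate_eqI singletonD subsetD)
      then show False using gt by (simp add: eval_nat_numeral)
    qed
    then obtain x where "x \<in> set ms" "x \<noteq> 2" by blast
    then show ?thesis using defect_4_ge[OF 2 ms, of x 3] ms by force
  next
    case 3
    then show ?thesis using defect_bounds(1)[OF ms] by simp
  qed
qed

text \<open>Hurwitz's bound 84(g - 1) at genus g = 2, for quotients of genus 0: the excess
  \<open>2 / real k\<close> is at least 1/42.\<close>

lemma order_le_84:
  assumes ms: "\<forall>m\<in>set ms. m \<ge> (2::nat)" and eq: "(\<Sum>m\<leftarrow>ms. 1 - 1 / real m) = 2 + 2 / real k" and k: "k > 0"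
  shows "k \<le> 84"
proof -
  have "2 + 1 / 42 \<le> 2 + 2 / real k" using defect_gap[OF ms] eq k by simp
  then show ?thesis using k by (simp add: field_simps)
qed

section \<open>Genus 0 signatures that pass the arithmetic\<close>

text \<open>An even entry other than 2 is at least 4, which bounds \<open>k\<close> by 8. The
  alternatives are permutations of (2,2,4,4), (2,2,2,6) and (2,2,2,4), described by what their
  exclusion uses.\<close>

lemma genus_0_signatures_length_4:
  assumes ms: "\<forall>m\<in>set ms. m \<ge> 2 \<and> m dvd k \<and> even m" and k: "k > 0" and len: "length ms = 4"
    and eq: "(\<Sum>m\<leftarrow>ms. 1 - 1 / real m) = 2 + 2 / real k"
  shows "k = 4 \<and> 2 \<in> set ms \<and> 4 \<in> set ms \<or>
    k = 6 \<and> length (filter (\<lambda>m. m \<noteq> 2) ms) = 1 \<and> 6 \<in> set ms \<or>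
    k = 8 \<and> length (filter (\<lambda>m. m = 2) ms) = 3 \<and> 4 \<in> set ms"
proof -
  obtain a b c d where abcd: "ms = [a, b, c, d]" using len by (rule length_eq_4E)
  have "\<not> set ms \<subseteq> {2}"
  proof
    assume "set ms \<subseteq> {2}"
    then have "ms = replicate 4 2" using len by (metis replicate_eqI singletonD subsetD)
    then show False using eq k by (simp add: eval_nat_numeral)
  qed
  then obtain x where x: "x \<in> set ms" "x \<noteq> 2" by blast
  then have "x \<ge> 4" using ms by (auto elim!: evenE)
  then have "5 / 2 - 1 / 4 \<le> 2 + 2 / real k" using defect_4_ge[OF len _ x(1), of 4] ms eq by simp
  then have "k \<le> 8" using k by (simp add: field_simps)
  moreover have "even k" using ms abcd by auto
  ultimately consider "k = 2" | "k = 4" | "k = 6" | "k = 8" using k by (elim evenE) force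
  moreover have m: "m \<ge> 2" "m \<le> k" "m dvd k" "even m" if "m \<in> set ms" for m
    using ms that k dvd_imp_le by blast+
  ultimately show ?thesis
  proof cases
    case 1
    have "m = 2" if "m \<in> set ms" for m using m[OF that] 1 by simp
    then show ?thesis using x by simp
  next
    case 2
    have "m = 2 \<or> m = 4" if "m \<in> set ms" for m
    proof -
      have "m \<le> 4" "m \<ge> 2" "even m" using m[OF that] 2 by auto
      then show ?thesis by (elim evenE) force
    qed
    then have "a = 2 \<or> a = 4" "b = 2 \<or> b = 4" "c = 2 \<or> c = 4" "d = 2 \<or> d = 4"
      by (simp_all add: abcd)
    then show ?thesis using eq 2 by (elim disjE) (simp_all add: abcd)
  next
    case 3
    have "m = 2 \<or> m = 6" if "m \<in> set ms" for m
    proof -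
      have "m \<le> 6" "m \<ge> 2" "even m" "m \<noteq> 4" using m[OF that] 3 by auto
      then show ?thesis by (elim evenE) force
    qed
    then have "a = 2 \<or> a = 6" "b = 2 \<or> b = 6" "c = 2 \<or> c = 6" "d = 2 \<or> d = 6"
      by (simp_all add: abcd)
    then show ?thesis using eq 3 by (elim disjE) (simp_all add: abcd)
  next
    case 4
    have "m = 2 \<or> m = 4 \<or> m = 8" if "m \<in> set ms" for m
    proof -
      have "m \<le> 8" "m \<ge> 2" "even m" "m \<noteq> 6" using m[OF that] 4 by auto
      then show ?thesis by (elim evenE) force
    qed
    then have "a = 2 \<or> a = 4 \<or> a = 8" "b = 2 \<or> b = 4 \<or> b = 8" "c = 2 \<or> c = 4 \<or> c = 8" "d = 2 \<or> d = 4 \<or> d = 8"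
      by (simp_all add: abcd)
    then show ?thesis using eq 4 by (elim disjE) (simp_all add: abcd)
  qed
qed

text \<open>The sum is at least 5/2, which gives \<open>k \<le> 4\<close>, and the even entry makes
  \<open>k\<close> even.\<close>

lemma genus_0_signatures_length_ge_5:
  assumes ms: "\<forall>m\<in>set ms. m \<ge> 2 \<and> m dvd k" and k: "k > 0" and len: "length ms \<ge> 5"
    and even: "x \<in> set ms" "even x"
    and eq: "(\<Sum>m\<leftarrow>ms. 1 - 1 / real m) = 2 + 2 / real k"
  shows "ms = [2, 2, 2, 2, 2] \<or> ms = [2, 2, 2, 2, 2, 2]"
proof -
  have lb: "real (length ms) / 2 \<le> 2 + 2 / real k" using defect_bounds(1)[of ms] ms eq by simp
  then have "5 / 2 \<le> 2 + 2 / real k" using len by simp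
  then have "k \<le> 4" using k by (simp add: field_simps)
  moreover have "even k" using ms even dvd_trans by blast
  ultimately consider "k = 2" | "k = 4" using k by (elim evenE) force
  then obtain n where n: "n = 5 \<or> n = 6" "ms = replicate n 2"
  proof cases
    case 1
    have "m = 2" if "m \<in> set ms" for m using ms that 1 dvd_imp_le[of m 2] by force
    then have r: "ms = replicate (length ms) 2" by (metis replicate_eqI)
    have "(\<Sum>m\<leftarrow>replicate n 2. 1 - 1 / real m) = real n / 2" for n by (induction n) auto
    then have "(\<Sum>m\<leftarrow>ms. 1 - 1 / real m) = real (length ms) / 2" using r by metis
    then have "length ms = 6" using eq 1 by simp
    then show ?thesis using that r by metis
  next
    case 2
    \<comment> \<open>Five entries already reach 5/2, the sum for \<open>k = 4\<close>, so every
      entry attains its minimum 2.\<close>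
    then have "length ms = 5" using lb len by simp
    then show ?thesis using that defect_bounds(3)[of ms] ms eq 2 by simp
  qed
  then show ?thesis by (auto simp: eval_nat_numeral)
qed

section \<open>Signatures occurring for the genera 2 and 180\<close>

lemma (in group) commute_if_ord_eq_order:
  assumes fin: "finite (carrier G)" and y: "y \<in> carrier G" "ord y = order G"
    and ab: "a \<in> carrier G" "b \<in> carrier G"
  shows "a \<otimes> b = b \<otimes> a"
proof -
  have "generate G {y} \<subseteq> carrier G" using y generate_in_carrier[of "{y}"] by blast
  moreover have "card (generate G {y}) = card (carrier G)"
    using generate_pow_card[OF y(1)] y(2) by (simp add: order_def)
  ultimately have "generate G {y} = carrier G" using fin card_subset_eq by blast
  then have "\<exists>i::int. x = y [^] i" if "x \<in> carrier G" for x
    using that generate_pow[OF y(1)] by blast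
  then obtain i j :: int where "a = y [^] i" "b = y [^] j" using ab by metis
  then show ?thesis using y(1) by (simp add: add.commute flip: int_pow_mult)
qed

text \<open>Noncommutativity makes \<open>\<one>\<close>, \<open>a\<close>, \<open>b\<close>,
  \<open>a \<otimes> b\<close> and \<open>b \<otimes> a\<close> distinct.\<close>

lemma (in group) order_ge_5_if_not_commute:
  assumes fin: "finite (carrier G)" and ab: "a \<in> carrier G" "b \<in> carrier G" "a \<otimes> b \<noteq> b \<otimes> a"
  shows "order G \<ge> 5"
proof -
  have "a \<noteq> \<one>" "b \<noteq> \<one>" "a \<noteq> b" using ab by auto
  moreover have "a \<otimes> b \<noteq> a" "a \<otimes> b \<noteq> b" "b \<otimes> a \<noteq> a" "b \<otimes> a \<noteq> b" using ab calculation by auto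
  moreover have "a \<otimes> b \<noteq> \<one>" "b \<otimes> a \<noteq> \<one>" using ab inv_comm by metis+
  ultimately have "card {\<one>, a, b, a \<otimes> b, b \<otimes> a} = 5" using ab(3) by simp
  moreover have "{\<one>, a, b, a \<otimes> b, b \<otimes> a} \<subseteq> carrier G" using ab by auto
  ultimately show ?thesis using fin card_mono order_def by metis
qed

lemma generating_vector_genus_0D:
  assumes "generating_vector G (0, ms) as bs cs" "group G"
  shows "map (group.ord G) cs = ms" "set cs \<subseteq> carrier G" "generate G (set cs) = carrier G"
    "list_prod G cs = \<one>\<^bsub>G\<^esub>"
proof -
  interpret group G by fact
  have "length cs = length ms" "\<forall>i<length ms. ord (cs ! i) = ms ! i"
    using assms by (auto simp: generating_vector_def)
  then show "map ord cs = ms" by (simp add: list_eq_iff_nth_eq)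
  show cs: "set cs \<subseteq> carrier G" "generate G (set cs) = carrier G"
    using assms by (auto simp: generating_vector_def)
  then show "list_prod G cs = \<one>\<^bsub>G\<^esub>" using assms by (auto simp: generating_vector_def)
qed

text \<open>An element of order 6 makes the group cyclic, so the elements with square
  \<open>\<one>\<close> form a subgroup. The relation forces the only entry that is not an
  involution into it, although its order is 6. This excludes (2,2,2,6).\<close>

lemma (in group) no_order_6_one_non_involution:
  assumes fin: "finite (carrier G)" "order G = 6" and cs: "set cs \<subseteq> carrier G" "list_prod G cs = \<one>"
    and ord: "length (filter (\<lambda>c. ord c \<noteq> 2) cs) = 1" "y \<in> set cs" "ord y = 6"
  shows False
proof -
  define K where "K = {g \<in> carrier G. g \<otimes> g = \<one>}"
  have comm: "a \<otimes> b = b \<otimes> a" if "a \<in> carrier G" "b \<in> carrier G" for a b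
    using commute_if_ord_eq_order[OF fin(1), of y] that ord cs fin(2) by auto
  have "subgroup K G"
  proof (rule subgroupI)
    show "K \<subseteq> carrier G" "K \<noteq> {}" by (auto simp: K_def)
    show "inv g \<in> K" if "g \<in> K" for g using that by (auto simp: K_def simp flip: inv_mult_group)
    show "g \<otimes> h \<in> K" if "g \<in> K" "h \<in> K" for g h
    proof -
      have "(g \<otimes> h) \<otimes> (g \<otimes> h) = (g \<otimes> g) \<otimes> (h \<otimes> h)"
        using that comm[of h "g \<otimes> h"] by (simp add: K_def m_assoc)
      then show ?thesis using that by (simp add: K_def)
    qed
  qed
  moreover have "length (filter (\<lambda>c. c \<notin> K) cs) \<le> 1"
  proof -
    have "c \<in> K" if "c \<in> set cs" "ord c = 2" for c
    proof -
      have "c \<in> carrier G" using that cs by blast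
      then show ?thesis using pow_ord_eq_1[of c] that(2) by (simp add: K_def numeral_2_eq_2)
    qed
    then have "filter (\<lambda>c. c \<notin> K) cs = filter (\<lambda>c. c \<notin> K) (filter (\<lambda>c. ord c \<noteq> 2) cs)"
      by (auto simp: filter_filter intro!: filter_cong)
    then show ?thesis using ord(1) by (metis length_filter_le)
  qed
  ultimately have "y \<in> K" using subset_subgroup_if_list_prod_eq_one cs ord(2) by blast
  then have "y [^] (2::nat) = \<one>" "y \<in> carrier G" by (auto simp: K_def numeral_2_eq_2)
  then have "ord y dvd 2" using pow_eq_id by blast
  then show False using ord(3) by (auto dest: dvd_imp_le)
qed

section \<open>Exclusion of (2,2,4,4) and (2,2,2,4)\<close>

context twisted_hom
begin

text \<open>An element of order 4 and \<open>z\<close> already give all \<open>4 * p\<close>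
  elements, yet an involution of sign -1 cannot lie among them.\<close>

lemma no_order_4p:
  assumes k: "k = 4" and cs: "set cs \<subseteq> carrier G" "\<And>c. c \<in> set cs \<Longrightarrow> \<epsilon> c = - 1"
    and ord: "2 \<in> ord ` set cs" "4 \<in> ord ` set cs"
  shows False
proof -
  obtain g y where gy: "g \<in> set cs" "ord g = 2" "y \<in> set cs" "ord y = 4" using ord by force
  then have y: "y \<in> carrier G" "\<epsilon> y = - 1" and g: "g \<in> carrier G" "\<epsilon> g = - 1" using cs by auto
  have "coprime (ord y) p" using gy(4) odd coprime_power_left_iff[of 2 2 p] by simp
  then have "card (carrier G) \<le> card (cyclic_ext G y z)"
    using card_cyclic_ext[OF y(1)] gy(4) order k by (simp add: order_def)
  then have "cyclic_ext G y z = carrier G"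
    using subgroup.subset[OF subgroup_cyclic_ext[OF y(1)]] finite by (simp add: card_seteq)
  then show False using involution_notin_cyclic_ext[OF y _ g(2) gy(2)] gy(4) g(1) by simp
qed

text \<open>The entry \<open>y\<close> of order 4 and \<open>z\<close> give a subgroup of index at
  most 2. It contains \<open>y\<close> but none of the three involutions, and a product with three
  factors outside it is not \<open>\<one>\<close>.\<close>

lemma no_order_8p:
  assumes k: "k = 8" and cs: "set cs \<subseteq> carrier G" "list_prod G cs = \<one>" "length cs = 4"
      "\<And>c. c \<in> set cs \<Longrightarrow> \<epsilon> c = - 1"
    and ord: "length (filter (\<lambda>c. ord c = 2) cs) = 3" "4 \<in> ord ` set cs"
  shows False
proof -
  obtain y where y: "y \<in> set cs" "ord y = 4" "y \<in> carrier G" "\<epsilon> y = - 1" using ord cs by force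
  define H where "H = cyclic_ext G y z"
  have sub: "subgroup H G" using subgroup_cyclic_ext[OF y(3)] by (simp add: H_def)
  have "coprime (ord y) p" using y(2) odd coprime_power_left_iff[of 2 2 p] by simp
  then have card: "order G \<le> 2 * card H"
    using card_cyclic_ext[OF y(3)] y(2) order k by (simp add: H_def)
  have "y [^] (1::int) \<otimes> z [^] (0::int) \<in> H" unfolding H_def cyclic_ext_def by blast
  then have yH: "y \<in> H" using y z by simp
  have "c \<notin> H \<longleftrightarrow> ord c = 2" if c: "c \<in> set cs" for c
  proof
    show "c \<notin> H" if "ord c = 2"
      using involution_notin_cyclic_ext[OF y(3,4) _ cs(4)[OF c] that] y(2) by (simp add: H_def)
    show "ord c = 2" if "c \<notin> H"
    proof (rule ccontr)
      assume "ord c \<noteq> 2"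
      \<comment> \<open>Only one of the four entries has order other than 2, so \<open>c\<close>
        would be \<open>y\<close>.\<close>
      moreover have "length (filter (\<lambda>c. ord c \<noteq> 2) cs) = 1"
        using sum_length_filter_compl[of "\<lambda>c. ord c = 2" cs] ord(1) cs(3) by simp
      then obtain x where "filter (\<lambda>c. ord c \<noteq> 2) cs = [x]" by (auto simp: length_Suc_conv)
      then have x: "set (filter (\<lambda>c. ord c \<noteq> 2) cs) = {x}" by (metis list.set(1) list.set(2))
      ultimately have "c \<in> {x}" "y \<in> {x}" unfolding x[symmetric] using c y(1,2) by simp_all
      then have "c = y" by simp
      then show False using that yH by simp
    qed
  qed
  then have "filter (\<lambda>c. c \<notin> H) cs = filter (\<lambda>c. ord c = 2) cs" by (auto intro: filter_cong)
  then show False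
    using list_prod_in_subgroup_of_large_card[OF sub finite card cs(1)] cs(2) ord(1)
      subgroup.one_closed[OF sub] by simp
qed

end

text \<open>
  Since \<open>179 = 2 \<cdot> 89 + 1\<close> with \<open>89\<close> prime, an action of a group of order \<open>179 k\<close> with \<open>k < 89\<close> on a
  normal subgroup of order \<open>179\<close> is by \<open>\<plusminus>1\<close>.
\<close>

lemma gcd_178:
  fixes k :: nat
  assumes "0 < k" "k < 89" shows "gcd (k * 179) (179 - 1) dvd 2"
proof -
  have p: "prime (89::nat)" by simp
  have "\<not> 89 dvd k" using assms by (auto dest: dvd_imp_le)
  moreover have "\<not> 89 dvd (179 :: nat)" by simp
  ultimately have "\<not> 89 dvd k * 179" using p prime_dvd_mult_iff by blast
  then have "coprime 89 (k * 179)" using p prime_imp_coprime by blast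
  then have "coprime 89 (gcd (k * 179) 178)" by (metis coprime_divisors dvd_refl gcd_dvd1)
  moreover have "gcd (k * 179) 178 dvd 89 * 2" by simp
  ultimately show ?thesis by (simp only: coprime_commute[of 89] coprime_dvd_mult_right_iff) simp
qed

section \<open>Comparison of genera 2 and 180\<close>

text \<open>The group of order \<open>k * 179\<close> supplies the sign and all exclusions except
  that of (2,2,2,6), which already fails for the group of order \<open>k = 6\<close> in genus
  2.\<close>

lemma genus_0_signatures:
  fixes G :: "('a, 'c) monoid_scheme" and G' :: "('b, 'd) monoid_scheme"
  assumes ms: "\<forall>m\<in>set ms. m \<ge> 2 \<and> m dvd k" and eq: "(\<Sum>m\<leftarrow>ms. 1 - 1 / real m) = 2 + 2 / real k"
    and G': "group G'" "finite (carrier G')" "order G' = k" "generating_vector G' (0, ms) as' bs' cs'"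
    and G: "group G" "finite (carrier G)" "order G = k * 179" "generating_vector G (0, ms) as bs cs"
  shows "ms = [2, 2, 2, 2, 2] \<or> ms = [2, 2, 2, 2, 2, 2]"
proof -
  have k: "0 < k" "k \<le> 84"
  proof -
    interpret G': group G' by fact
    show "0 < k" using G'(2,3) G'.order_gt_0_iff_finite by simp
    then show "k \<le> 84" using order_le_84[of ms k] ms eq by blast
  qed
  have p: "prime (179::nat)" by simp
  interpret group G by fact
  note cs = generating_vector_genus_0D[OF G(4) G(1)]
  obtain z \<epsilon> f where "twisted_hom G 179 k z \<epsilon> f"
    using exists_twisted_hom[OF G(2,3) _ p _ gcd_178] k by auto
  then interpret twisted_hom G 179 k z \<epsilon> f .
  have ordc: "ord c \<in> set ms" if "c \<in> set cs" for c using cs(1) that by auto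
  have "coprime (ord c) 179" if "c \<in> set cs" for c
  proof -
    have "ord c dvd k" using ms ordc that by blast
    moreover have "\<not> 179 dvd k" using k by (auto dest: dvd_imp_le)
    ultimately have "\<not> 179 dvd ord c" using dvd_trans by blast
    then show ?thesis using p prime_imp_coprime coprime_commute by blast
  qed
  then have F: "4 \<le> length (filter (\<lambda>c. \<epsilon> c = - 1) cs)" using four_sign_changes[OF cs(2-4)] by blast
  then have len: "4 \<le> length cs" using length_filter_le order_trans by blast
  have lm: "length ms = length cs" using cs(1) by auto
  have st: "set ms = ord ` set cs" unfolding cs(1)[symmetric] by simp
  have "filter (\<lambda>c. \<epsilon> c = - 1) cs \<noteq> []" using F by auto
  then obtain c where c: "c \<in> set cs" "\<epsilon> c = - 1" by (auto simp: filter_empty_conv)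
  show ?thesis
  proof (cases "length ms \<ge> 5")
    case True
    have "even (ord c)" using even_ord c cs(2) by blast
    then show ?thesis using genus_0_signatures_length_ge_5[OF ms k(1) True ordc[OF c(1)] _ eq] by blast
  next
    case False
    then have l4: "length ms = 4" "length cs = 4" using len lm by auto
    \<comment> \<open>Of the four entries at least four have sign -1, so all do, and all orders are
      even.\<close>
    have sgn: "\<epsilon> c = - 1" if "c \<in> set cs" for c
      using length_filter_less[OF that, of "\<lambda>c. \<epsilon> c = - 1"] F l4 by fastforce
    have "\<forall>m\<in>set ms. m \<ge> 2 \<and> m dvd k \<and> even m"
      using ms even_ord sgn cs(2) unfolding st by blast
    from genus_0_signatures_length_4[OF this k(1) l4(1) eq] show ?thesis
    proof (elim disjE conjE)
      assume "k = 4" "2 \<in> set ms" "4 \<in> set ms"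
      then show ?thesis using no_order_4p[OF _ cs(2) sgn] st by blast
    next
      assume *: "k = 6" "length (filter (\<lambda>m. m \<noteq> 2) ms) = 1" "6 \<in> set ms"
      interpret G': group G' by fact
      note cs' = generating_vector_genus_0D[OF G'(4) G'(1)]
      obtain y where "y \<in> set cs'" "G'.ord y = 6" using *(3) cs'(1) by auto
      moreover have "length (filter (\<lambda>c. G'.ord c \<noteq> 2) cs') = 1"
        using *(2) unfolding cs'(1)[symmetric] by (simp add: filter_map comp_def)
      ultimately show ?thesis
        using G'.no_order_6_one_non_involution[OF G'(2) _ cs'(2,4)] G'(3) *(1) by blast
    next
      assume *: "k = 8" "length (filter (\<lambda>m. m = 2) ms) = 3" "4 \<in> set ms"
      have "length (filter (\<lambda>c. ord c = 2) cs) = 3"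
        using *(2) unfolding cs(1)[symmetric] by (simp add: filter_map comp_def)
      then show ?thesis using no_order_8p[OF *(1) cs(2,4) l4(2) sgn] *(3) st by blast
    qed
  qed
qed

text \<open>With r entries, the sum being at least r/2 gives \<open>length ms * k \<le> 4\<close>.
  If r = 1, the nontrivial entry is the inverse of a commutator, so the group is nonabelian and of
  order at least 5. If r is at least 2, then \<open>k = 2\<close> and both entries attain the
  minimum.\<close>

lemma (in group) genus_1_signatures:
  assumes ms: "\<forall>m\<in>set ms. m \<ge> 2 \<and> m dvd k" and eq: "(\<Sum>m\<leftarrow>ms. 1 - 1 / real m) = 2 / real k"
    and G: "finite (carrier G)" "order G = k" "generating_vector G (1, ms) as bs cs"
  shows "ms = [2, 2]"
proof -
  have k: "k > 0" using G by (metis order_gt_0_iff_finite)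
  have "real (length ms) / 2 \<le> 2 / real k" using defect_bounds(1)[of ms] ms eq by simp
  then have "real (length ms * k) \<le> real 4" using k by (simp add: field_simps)
  then have rk: "length ms * k \<le> 4" by (simp only: of_nat_le_iff)
  have "ms \<noteq> []" using eq k by auto
  then obtain m where m: "m \<in> set ms" "m \<ge> 2" "m dvd k" using ms by (metis last_in_set)
  then have k2: "k \<ge> 2" using k dvd_imp_le[OF m(3)] by linarith
  consider "length ms = 1" | "length ms \<ge> 2" using \<open>ms \<noteq> []\<close> by (cases ms) (auto simp: Suc_le_eq)
  then show ?thesis
  proof cases
    case 1
    then have "length as = 1" "length bs = 1" "length cs = 1" using G(3) by (auto simp: generating_vector_def)
    then obtain a b c where abc: "as = [a]" "bs = [b]" "cs = [c]" by (auto simp: length_Suc_conv)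
    have c: "a \<in> carrier G" "b \<in> carrier G" "c \<in> carrier G" "commutator G a b \<otimes> c = \<one>" "ord c = ms ! 0"
      using G(3) 1 by (auto simp: generating_vector_def abc commutator_def)
    have "ms ! 0 \<ge> 2" using ms 1 by simp
    then have "c \<noteq> \<one>" using c(5) by auto
    have "a \<otimes> b \<noteq> b \<otimes> a"
    proof
      assume "a \<otimes> b = b \<otimes> a"
      then have "commutator G a b = \<one>" using c by (simp add: commutator_def m_assoc)
      then show False using c \<open>c \<noteq> \<one>\<close> by simp
    qed
    then show ?thesis using order_ge_5_if_not_commute[OF G(1) c(1,2)] rk 1 G(2) by simp
  next
    case 2
    then have "2 * k \<le> length ms * k" by simp
    then have "k = 2" using rk k2 by linarith
    then have "length ms = 2" using rk 2 by simp
    then show ?thesis using defect_bounds(3)[of ms] ms eq \<open>k = 2\<close> by (simp add: numeral_2_eq_2)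
  qed
qed

lemma riemann_signaturesE:
  assumes "(h, ms) \<in> riemann_signatures \<sigma>"
  obtains G :: "nat monoid" and as bs cs where "group G" "finite (carrier G)" "\<forall>m\<in>set ms. m dvd order G"
    "real \<sigma> - 1 = real (order G) * (real h - 1 + 1 / 2 * (\<Sum>m\<leftarrow>ms. 1 - 1 / real m))"
    "generating_vector G (h, ms) as bs cs"
  using assms unfolding riemann_signatures_def by blast

lemma signatures_of_genus_2_and_180:
  assumes "(h, ms) \<in> riemann_signatures 2" "(h, ms) \<in> riemann_signatures 180"
  shows "(h, ms) \<in> {(2, []), (1, [2, 2]), (0, [2, 2, 2, 2, 2]), (0, [2, 2, 2, 2, 2, 2])}"
proof -
  define S where "S = (\<Sum>m\<leftarrow>ms. 1 - 1 / real m)"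
  obtain G' :: "nat monoid" and as' bs' cs' where G': "group G'" "finite (carrier G')"
    "\<forall>m\<in>set ms. m dvd order G'" "real 2 - 1 = real (order G') * (real h - 1 + 1 / 2 * S)"
    "generating_vector G' (h, ms) as' bs' cs'"
    using riemann_signaturesE[OF assms(1)] unfolding S_def by metis
  obtain G :: "nat monoid" and as bs cs where G: "group G" "finite (carrier G)"
    "real 180 - 1 = real (order G) * (real h - 1 + 1 / 2 * S)"
    "generating_vector G (h, ms) as bs cs"
    using riemann_signaturesE[OF assms(2)] unfolding S_def by metis
  define k where "k = order G'"
  interpret G': group G' by fact
  have k: "k \<ge> 1" using G'(2) G'.order_gt_0_iff_finite by (simp add: k_def)
  \<comment> \<open>Genus 2 has \<open>\<sigma> - 1 = 1\<close>, so the bracket is the reciprocal of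
    the order; genus 180 then forces order \<open>k * 179\<close>.\<close>
  have \<mu>: "real h - 1 + 1 / 2 * S = 1 / real k" using G'(4) k by (simp add: k_def field_simps)
  have "real (order G) = real (k * 179)" using G(3) k unfolding \<mu> by (simp add: field_simps)
  then have o: "order G = k * 179" by (simp only: of_nat_eq_iff)
  have ms2: "\<forall>m\<in>set ms. m \<ge> 2" using assms(1) by (auto simp: riemann_signatures_def)
  then have ms: "\<forall>m\<in>set ms. m \<ge> 2 \<and> m dvd k" using G'(3) by (simp add: k_def)
  have k1: "1 / real k \<le> 1" using k by simp
  have S: "real (length ms) / 2 \<le> S" using defect_bounds(1)[OF ms2] by (simp add: S_def)
  \<comment> \<open>\<open>real h - 1\<close> is at most \<open>1 / real k\<close>, hence at most 1,
    since \<open>S\<close> is nonnegative.\<close>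
  have "h \<le> 2" using \<mu> k1 S by linarith
  then consider "h = 0" | "h = 1" | "h = 2" by linarith
  then show ?thesis
  proof cases
    case 1
    then have "S = 2 + 2 / real k" using \<mu> by simp
    then show ?thesis
      using genus_0_signatures[OF ms _ G'(1,2) k_def[symmetric] _ G(1,2) o] G'(5) G(4) 1
      unfolding S_def by blast
  next
    case 2
    then have "S = 2 / real k" using \<mu> by simp
    then show ?thesis using G'.genus_1_signatures[OF ms _ G'(2) k_def[symmetric]] G'(5) 2
      unfolding S_def by blast
  next
    case 3
    then have "real h = 2" by simp
    then have "real (length ms) \<le> 0" using \<mu> k1 S by linarith
    then show ?thesis using 3 by simp
  qed
qed

section \<open>Cyclic and dihedral groups\<close>

lemma (in group) ord_eq_2:
  assumes "x \<in> carrier G" "x \<noteq> \<one>" "x \<otimes> x = \<one>" shows "ord x = 2"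
proof -
  have "x [^] (2::nat) = \<one>" using assms by (simp add: numeral_2_eq_2)
  then have "ord x dvd 2" using assms(1) pow_eq_id by blast
  then show ?thesis using assms(1,2) ord_eq_1 prime_nat_iff two_is_prime_nat by blast
qed

lemma (in group) commutator_one: "a \<in> carrier G \<Longrightarrow> commutator G a \<one> = \<one>"
  by (simp add: commutator_def)

definition cyclic :: "nat \<Rightarrow> nat monoid" where
  "cyclic n = \<lparr>carrier = {..<n}, mult = (\<lambda>x y. (x + y) mod n), one = 0\<rparr>"

lemma cyclic_simps [simp]:
  "carrier (cyclic n) = {..<n}" "x \<otimes>\<^bsub>cyclic n\<^esub> y = (x + y) mod n" "\<one>\<^bsub>cyclic n\<^esub> = 0"
  by (simp_all add: cyclic_def)

lemma group_cyclic: "n > 0 \<Longrightarrow> group (cyclic n)"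
proof (rule groupI)
  fix x assume n: "n > 0" and "x \<in> carrier (cyclic n)"
  then have "(n - x) mod n \<in> carrier (cyclic n)" "(n - x) mod n \<otimes>\<^bsub>cyclic n\<^esub> x = \<one>\<^bsub>cyclic n\<^esub>"
    by (simp_all add: mod_add_left_eq)
  then show "\<exists>y\<in>carrier (cyclic n). y \<otimes>\<^bsub>cyclic n\<^esub> x = \<one>\<^bsub>cyclic n\<^esub>" by blast
qed (simp_all add: mod_add_left_eq mod_add_right_eq add.assoc)

text \<open>
  The rotation \<open>r\<^sup>i\<close> of the dihedral group of order \<open>2 n\<close> is encoded as \<open>2 i\<close> and the reflection
  \<open>r\<^sup>i s\<close> as \<open>2 i + 1\<close>, where \<open>0 \<le> i < n\<close>.
\<close>

definition dihedral_elem :: "nat \<Rightarrow> int \<Rightarrow> bool \<Rightarrow> nat" where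
  "dihedral_elem n i e = 2 * nat (i mod int n) + of_bool e"

definition dihedral :: "nat \<Rightarrow> nat monoid" where
  "dihedral n = \<lparr>carrier = {..<2 * n},
     mult = (\<lambda>x y. dihedral_elem n
       (int (x div 2) + (if odd x then - int (y div 2) else int (y div 2))) (odd x \<noteq> odd y)),
     one = 0\<rparr>"

lemma carrier_dihedral [simp]: "carrier (dihedral n) = {..<2 * n}"
  by (simp add: dihedral_def)

lemma dihedral_elem_eq_iff:
  assumes "n > 0"
  shows "dihedral_elem n i e = dihedral_elem n j f \<longleftrightarrow> [i = j] (mod int n) \<and> (e \<longleftrightarrow> f)"
proof -
  have "2 * a + of_bool e = 2 * b + of_bool f \<longleftrightarrow> a = b \<and> (e \<longleftrightarrow> f)" for a b :: nat
    by (cases e; cases f; simp; presburger?)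
  then show ?thesis using assms by (simp add: dihedral_elem_def cong_def eq_nat_nat_iff)
qed

lemma dihedral_elem_in_carrier: "n > 0 \<Longrightarrow> dihedral_elem n i e \<in> carrier (dihedral n)"
proof -
  assume "n > 0"
  then have "nat (i mod int n) < n" by (simp add: nat_less_iff)
  then show ?thesis by (simp add: dihedral_elem_def)
qed

lemma dihedral_elemE:
  assumes "x \<in> carrier (dihedral n)"
  obtains i e where "x = dihedral_elem n (int i) e"
proof
  show "x = dihedral_elem n (int (x div 2)) (odd x)"
    using assms by (auto simp: dihedral_elem_def nat_mod_as_int[symmetric] of_bool_def elim!: evenE oddE)
qed

lemma one_dihedral: "\<one>\<^bsub>dihedral n\<^esub> = dihedral_elem n 0 False"
  by (simp add: dihedral_def dihedral_elem_def)

text \<open>This is the relation \<open>s r = r^(-1) s\<close>: a reflection on the left inverts the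
  rotation part on its right.\<close>

lemma mult_dihedral:
  assumes n: "n > 0"
  shows "dihedral_elem n i e \<otimes>\<^bsub>dihedral n\<^esub> dihedral_elem n j f =
    dihedral_elem n (if e then i - j else i + j) (e \<noteq> f)"
proof -
  have d: "int (dihedral_elem n i e div 2) = i mod int n" "odd (dihedral_elem n i e) = e" for i e
    using n by (auto simp: dihedral_elem_def)
  show ?thesis unfolding dihedral_def monoid.simps d using n
    by (auto simp: dihedral_elem_eq_iff cong_def mod_simps)
qed

lemmas dihedral_simps = mult_dihedral one_dihedral dihedral_elem_eq_iff

lemma group_dihedral:
  assumes n: "n > 0" shows "group (dihedral n)"
proof (rule groupI)
  let ?G = "dihedral n"
  show "x \<otimes>\<^bsub>?G\<^esub> y \<in> carrier ?G" if "x \<in> carrier ?G" "y \<in> carrier ?G" for x y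
    using that n by (auto elim!: dihedral_elemE simp: mult_dihedral simp del: carrier_dihedral
      intro!: dihedral_elem_in_carrier)
  show "\<one>\<^bsub>?G\<^esub> \<in> carrier ?G" using n by (simp add: one_dihedral dihedral_elem_in_carrier del: carrier_dihedral)
  show "x \<otimes>\<^bsub>?G\<^esub> y \<otimes>\<^bsub>?G\<^esub> z = x \<otimes>\<^bsub>?G\<^esub> (y \<otimes>\<^bsub>?G\<^esub> z)"
    if "x \<in> carrier ?G" "y \<in> carrier ?G" "z \<in> carrier ?G" for x y z
    using that n by (elim dihedral_elemE) (auto simp: dihedral_simps algebra_simps)
  show "\<one>\<^bsub>?G\<^esub> \<otimes>\<^bsub>?G\<^esub> x = x" if "x \<in> carrier ?G" for x
    using that n by (elim dihedral_elemE) (auto simp: dihedral_simps)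
  show "\<exists>y\<in>carrier ?G. y \<otimes>\<^bsub>?G\<^esub> x = \<one>\<^bsub>?G\<^esub>" if x: "x \<in> carrier ?G" for x
  proof -
    obtain i e where x: "x = dihedral_elem n (int i) e" using x by (rule dihedral_elemE)
    have "dihedral_elem n (if e then int i else - int i) e \<otimes>\<^bsub>?G\<^esub> x = \<one>\<^bsub>?G\<^esub>"
      using n by (simp add: x dihedral_simps)
    then show ?thesis using dihedral_elem_in_carrier[OF n] by blast
  qed
qed

text \<open>The rotation \<open>r\<close> is either given or is the product of the reflections
  \<open>r s\<close> and \<open>s\<close>; its powers together with \<open>s\<close> give
  everything.\<close>

lemma dihedral_generated:
  assumes n: "n > 0" and K: "subgroup K (dihedral n)"
    and s: "dihedral_elem n 0 True \<in> K" "dihedral_elem n 1 e \<in> K"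
  shows "K = carrier (dihedral n)"
proof
  show "K \<subseteq> carrier (dihedral n)" using K subgroup.subset by blast
  have r: "dihedral_elem n 1 False \<in> K"
    using s subgroup.m_closed[OF K s(2,1)] n by (cases e) (simp_all add: mult_dihedral)
  have i: "dihedral_elem n (int i) False \<in> K" for i
  proof (induction i)
    case 0
    show ?case using subgroup.one_closed[OF K] by (simp add: one_dihedral)
  next
    case (Suc i)
    show ?case using subgroup.m_closed[OF K r Suc] n by (simp add: mult_dihedral)
  qed
  show "carrier (dihedral n) \<subseteq> K"
  proof
    fix x assume "x \<in> carrier (dihedral n)"
    then obtain i e where "x = dihedral_elem n (int i) e" by (rule dihedral_elemE)
    then show "x \<in> K" using i[of i] subgroup.m_closed[OF K i[of i] s(1)] n
      by (cases e) (simp_all add: mult_dihedral)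
  qed
qed

lemma ord_dihedral:
  assumes n: "n > 0" and i: "e \<or> \<not> [i = 0] (mod int n) \<and> [2 * i = 0] (mod int n)"
  shows "group.ord (dihedral n) (dihedral_elem n i e) = 2"
proof -
  interpret group "dihedral n" using n by (rule group_dihedral)
  show ?thesis
    using dihedral_elem_in_carrier[OF n, of i e] i n by (intro ord_eq_2) (auto simp: dihedral_simps)
qed

section \<open>Realization of the four signatures\<close>

lemma riemann_signaturesI:
  fixes G :: "nat monoid"
  assumes "group G" "finite (carrier G)" "\<forall>m\<in>set ms. m \<ge> 2 \<and> m dvd order G"
    "real \<sigma> - 1 = real (order G) * (real h - 1 + 1 / 2 * (\<Sum>m\<leftarrow>ms. 1 - 1 / real m))"
    "generating_vector G (h, ms) as bs cs"
  shows "(h, ms) \<in> riemann_signatures \<sigma>"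
  using assms unfolding riemann_signatures_def by blast

text \<open>The bracket is \<open>h - 1 = 1\<close>, so the group has order
  \<open>n = \<sigma> - 1\<close>. In the cyclic group a generator padded by identities works, as
  all commutators are trivial.\<close>

lemma signature_2:
  assumes \<sigma>: "\<sigma> \<ge> 2" shows "(2, []) \<in> riemann_signatures \<sigma>"
proof -
  define n where "n = \<sigma> - 1"
  have n: "n > 0" "\<sigma> = n + 1" using \<sigma> by (simp_all add: n_def)
  interpret group "cyclic n" using n(1) by (rule group_cyclic)
  \<comment> \<open>For \<open>n = 1\<close> the generator must be 0, whence
    \<open>1 mod n\<close>.\<close>
  let ?S = "set [1 mod n, 0] \<union> set [0, 0] \<union> set []"
  have S: "?S \<subseteq> carrier (cyclic n)" using n(1) by simp
  have "generate (cyclic n) ?S = carrier (cyclic n)"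
  proof
    show "generate (cyclic n) ?S \<subseteq> carrier (cyclic n)" using generate_incl[OF S] .
    have "i < n \<Longrightarrow> i \<in> generate (cyclic n) ?S" for i
    proof (induction i)
      case 0
      show ?case by (rule generate.incl) simp
    next
      case (Suc i)
      have "1 mod n \<in> generate (cyclic n) ?S" by (rule generate.incl) simp
      from generate.eng[OF this Suc.IH] Suc.prems show ?case by simp
    qed
    then show "carrier (cyclic n) \<subseteq> generate (cyclic n) ?S" by auto
  qed
  moreover have "commutator (cyclic n) a \<one>\<^bsub>cyclic n\<^esub> = \<one>\<^bsub>cyclic n\<^esub>" if "a \<in> carrier (cyclic n)" for a
    using that by (rule commutator_one)
  then have "commutator (cyclic n) (1 mod n) 0 = 0" "commutator (cyclic n) 0 0 = 0" using n(1) by simp_all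
  ultimately have "generating_vector (cyclic n) (2, []) [1 mod n, 0] [0, 0] []"
    using S by (simp add: generating_vector_def)
  then show ?thesis
    by (intro riemann_signaturesI[of "cyclic n"]) (use n group_axioms in \<open>auto simp: order_def\<close>)
qed

text \<open>The bracket is 1/2, so the group has order \<open>2 * n\<close>. The pair
  \<open>r\<close>, \<open>\<one>\<close> has trivial commutator, and \<open>s\<close>,
  \<open>s\<close> has trivial product.\<close>

lemma signature_1_2_2:
  assumes \<sigma>: "\<sigma> \<ge> 2" shows "(1, [2, 2]) \<in> riemann_signatures \<sigma>"
proof -
  define n where "n = \<sigma> - 1"
  have n: "n > 0" "\<sigma> = n + 1" using \<sigma> by (simp_all add: n_def)
  interpret group "dihedral n" using n(1) by (rule group_dihedral)
  let ?r = "dihedral_elem n 1 False" and ?s = "dihedral_elem n 0 True"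
  have c: "?r \<in> carrier (dihedral n)" "?s \<in> carrier (dihedral n)"
    using dihedral_elem_in_carrier n(1) by blast+
  let ?S = "set [?r] \<union> set [\<one>\<^bsub>dihedral n\<^esub>] \<union> set [?s, ?s]"
  have "generate (dihedral n) ?S = carrier (dihedral n)"
    by (rule dihedral_generated[OF n(1) generate_is_subgroup, where e = False])
      (use c in \<open>auto intro: generate.incl simp del: carrier_dihedral\<close>)
  moreover have "commutator (dihedral n) ?r \<one>\<^bsub>dihedral n\<^esub> = \<one>\<^bsub>dihedral n\<^esub>"
    using c(1) by (rule commutator_one)
  moreover have "?s \<otimes>\<^bsub>dihedral n\<^esub> ?s = \<one>\<^bsub>dihedral n\<^esub>" using n(1) by (simp add: dihedral_simps)
  ultimately have "generating_vector (dihedral n) (1, [2, 2]) [?r] [\<one>\<^bsub>dihedral n\<^esub>] [?s, ?s]"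
    using c ord_dihedral[OF n(1), of True 0]
    by (auto simp: generating_vector_def nth_Cons simp del: carrier_dihedral split: nat.splits)
  then show ?thesis
    by (intro riemann_signaturesI[of "dihedral n"]) (use n group_axioms in \<open>auto simp: order_def\<close>)
qed

text \<open>Entries are given as pairs of an exponent and a reflection flag, so that the conditions
  on their orders become congruences modulo \<open>n\<close>.\<close>

lemma generating_vector_dihedral_genus_0:
  assumes n: "n > 0" and ms: "ms = replicate (length xs) 2"
    and gen: "(0, True) \<in> set xs" "(1, e) \<in> set xs"
    and ord: "\<forall>(i, e)\<in>set xs. e \<or> \<not> [i = 0] (mod int n) \<and> [2 * i = 0] (mod int n)"
    and prod: "list_prod (dihedral n) (map (case_prod (dihedral_elem n)) xs) = \<one>\<^bsub>dihedral n\<^esub>"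
  shows "generating_vector (dihedral n) (0, ms) [] [] (map (case_prod (dihedral_elem n)) xs)"
proof -
  interpret group "dihedral n" using n by (rule group_dihedral)
  let ?cs = "map (case_prod (dihedral_elem n)) xs"
  have c: "set ?cs \<subseteq> carrier (dihedral n)"
    using dihedral_elem_in_carrier[OF n] by (auto simp del: carrier_dihedral)
  have "dihedral_elem n 0 True \<in> set ?cs" "dihedral_elem n 1 e \<in> set ?cs"
    using gen by force+
  then have "generate (dihedral n) (set ?cs) = carrier (dihedral n)"
    using dihedral_generated[OF n generate_is_subgroup[OF c]] generate.incl by metis
  moreover have "group.ord (dihedral n) (?cs ! i) = 2" if "i < length xs" for i
    using that ord ord_dihedral[OF n] by (auto simp: split_beta dest!: nth_mem)
  ultimately show ?thesis using c ms prod by (simp add: generating_vector_def del: carrier_dihedral)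
qed

lemma signature_0_5:
  assumes \<sigma>: "\<sigma> \<ge> 2" shows "(0, [2, 2, 2, 2, 2]) \<in> riemann_signatures \<sigma>"
proof -
  define n where "n = \<sigma> - 1"
  have n: "n > 0" "\<sigma> = n + 1" using \<sigma> by (simp_all add: n_def)
  then have n2: "2 * n > 0" by simp
  \<comment> \<open>The bracket is 1/4, so the order is \<open>4 * n\<close>. The vector is
    \<open>s\<close>, \<open>r^n s\<close>, \<open>r s\<close>, \<open>r s\<close>,
    \<open>r^n\<close>: the first two multiply to \<open>r^(-n)\<close>, the equal pair cancels, and
    the involution \<open>r^n\<close> closes the product.\<close>
  have "generating_vector (dihedral (2 * n)) (0, [2, 2, 2, 2, 2]) [] []
      (map (case_prod (dihedral_elem (2 * n)))
        [(0, True), (int n, True), (1, True), (1, True), (int n, False)])"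
    by (rule generating_vector_dihedral_genus_0[OF n2, of _ _ True])
      (use n n2 in \<open>auto simp: dihedral_simps cong_def eval_nat_numeral\<close>)
  then show ?thesis
    by (intro riemann_signaturesI[of "dihedral (2 * n)"])
      (use n group_dihedral[OF n2] in \<open>auto simp: order_def\<close>)
qed

lemma signature_0_6:
  assumes \<sigma>: "\<sigma> \<ge> 2" shows "(0, [2, 2, 2, 2, 2, 2]) \<in> riemann_signatures \<sigma>"
proof -
  define n where "n = \<sigma> - 1"
  have n: "n > 0" "\<sigma> = n + 1" using \<sigma> by (simp_all add: n_def)
  \<comment> \<open>The bracket is 1/2, so the order is \<open>2 * n\<close>. Equal neighbours
    cancel in pairs, and \<open>s\<close> and \<open>r s\<close> generate.\<close>
  have "generating_vector (dihedral n) (0, [2, 2, 2, 2, 2, 2]) [] []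
      (map (case_prod (dihedral_elem n))
        [(0, True), (0, True), (0, True), (0, True), (1, True), (1, True)])"
    by (rule generating_vector_dihedral_genus_0[OF n(1), of _ _ True])
      (use n in \<open>auto simp: dihedral_simps cong_def eval_nat_numeral\<close>)
  then show ?thesis
    by (intro riemann_signaturesI[of "dihedral n"])
      (use n group_dihedral[OF n(1)] in \<open>auto simp: order_def\<close>)
qed

theorem theorem4p2:
  shows "(\<Inter>\<sigma>\<in>{2..}. riemann_signatures \<sigma>) =
           {(2, []), (1, [2, 2]), (0, [2, 2, 2, 2, 2]), (0, [2, 2, 2, 2, 2, 2])} \<and>
         ((\<forall>\<sigma>\<ge>2. actual_signatures \<sigma> = riemann_signatures \<sigma>) \<longrightarrow>
          (\<Inter>\<sigma>\<in>{2..}. actual_signatures \<sigma>) =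
            {(2, []), (1, [2, 2]), (0, [2, 2, 2, 2, 2]), (0, [2, 2, 2, 2, 2, 2])})"
proof -
  have "(\<Inter>\<sigma>\<in>{2..}. riemann_signatures \<sigma>) =
      {(2, []), (1, [2, 2]), (0, [2, 2, 2, 2, 2]), (0, [2, 2, 2, 2, 2, 2])}" (is "?L = ?R")
  proof
    show "?L \<subseteq> ?R"
    proof
      fix s assume s: "s \<in> ?L"
      obtain h ms where "s = (h, ms)" by force
      \<comment> \<open>Membership at the genera 2 and 180 already leaves only the four
        signatures.\<close>
      then show "s \<in> ?R" using s signatures_of_genus_2_and_180[of h ms] by simp
    qed
    show "?R \<subseteq> ?L" using signature_2 signature_1_2_2 signature_0_5 signature_0_6 by auto
  qed
  then show ?thesis by auto
qed

end
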